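(* Let $A,B$ be Boolean matrices of dimensions $a\times b$ and $b\times c$, let $C=AB$, and let $m_A,m_B,m_C$ be the numbers of $1$-entries of $A$, $B$, $C$, respectively. There is a deterministic combinatorial algorithm computing $C$ in time $\mathcal{O}\big((m_A+m_B)\log(m_A+m_B)+\sqrt{(ab+bc)\cdot\min(m_A,m_B)\cdot(a+c+m_C)\cdot\log(ab+bc)}\big)$.
   Context: $AB$ is the Boolean matrix product: $(AB)[i,j]=1$ iff there is $k$ with $A[i,k]=B[k,j]=1$. Matrices are represented by lists of coordinates of their $1$-entries, sorted by row index and then by column index. An algorithm is combinatorial if it does not use fast (algebraic) matrix multiplication as a subroutine. Model: word RAM with word size logarithmic in the input size. *)

theory Defs
  imports Complex_Main "HOL-Library.Log_Nat" "Jordan_Normal_Form.Matrix"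
begin

section \<open>Boolean matrices\<close>

definition bool_mat_mult :: "bool mat \<Rightarrow> bool mat \<Rightarrow> bool mat" where
  "bool_mat_mult A B =
     mat (dim_row A) (dim_col B) (\<lambda>(i, j). \<exists>k < dim_col A. A $$ (i, k) \<and> B $$ (k, j))"

definition num_ones :: "bool mat \<Rightarrow> nat" where
  "num_ones M = card {(i, j). i < dim_row M \<and> j < dim_col M \<and> M $$ (i, j)}"

text \<open>\<open>List.product\<close> enumerates the index pairs by row and then by column; filtering keeps this
  order. Indices start at 0.\<close>

definition coords :: "bool mat \<Rightarrow> (nat \<times> nat) list" where
  "coords M = filter (\<lambda>(i, j). M $$ (i, j)) (List.product [0..<dim_row M] [0..<dim_col M])"

definition encode_mat :: "bool mat \<Rightarrow> nat list" where
  "encode_mat M = concat (map (\<lambda>(i, j). [i, j]) (coords M))"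

definition encode_input :: "bool mat \<Rightarrow> bool mat \<Rightarrow> nat list" where
  "encode_input A B =
     [dim_row A, dim_col A, dim_col B, num_ones A, num_ones B] @ encode_mat A @ encode_mat B"

section \<open>Word RAM\<close>

text \<open>A machine with word size \<open>w\<close> has registers and memory cells holding words, i.e.\ numbers
  below \<open>2 ^ w\<close>, and memory addresses are words as well. Every instruction takes one time unit.
  A program is a finite list of instructions, so it uses a constant number of registers.\<close>

datatype arith = Add | Sub | Mul | Quot | Rem | BitAnd | BitOr | BitXor | ShiftL | ShiftR

datatype instr =
    Const nat nat              \<comment> \<open>\<open>Const r n\<close>: \<open>R[r] := n\<close>\<close>
  | Copy nat nat               \<comment> \<open>\<open>Copy r s\<close>: \<open>R[r] := R[s]\<close>\<close>
  | Arith arith nat nat nat    \<comment> \<open>\<open>Arith f r s t\<close>: \<open>R[r] := f R[s] R[t]\<close>\<close>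
  | Load nat nat               \<comment> \<open>\<open>Load r s\<close>: \<open>R[r] := M[R[s]]\<close>\<close>
  | Store nat nat              \<comment> \<open>\<open>Store r s\<close>: \<open>M[R[r]] := R[s]\<close>\<close>
  | Jump nat
  | JumpEq nat nat nat         \<comment> \<open>\<open>JumpEq r s l\<close>: go to \<open>l\<close> if \<open>R[r] = R[s]\<close>\<close>
  | JumpLess nat nat nat       \<comment> \<open>\<open>JumpLess r s l\<close>: go to \<open>l\<close> if \<open>R[r] < R[s]\<close>\<close>

record config =
  pc :: nat
  regs :: "nat \<Rightarrow> nat"
  mem :: "nat \<Rightarrow> nat"

fun arith_val :: "nat \<Rightarrow> arith \<Rightarrow> nat \<Rightarrow> nat \<Rightarrow> nat" where
  "arith_val w Add x y = (x + y) mod 2 ^ w"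
| "arith_val w Sub x y = (x + (2 ^ w - y)) mod 2 ^ w"
| "arith_val w Mul x y = (x * y) mod 2 ^ w"
| "arith_val w Quot x y = x div y"
| "arith_val w Rem x y = x mod y"
| "arith_val w BitAnd x y = Bit_Operations.and x y"
| "arith_val w BitOr x y = Bit_Operations.or x y"
| "arith_val w BitXor x y = Bit_Operations.xor x y"
| "arith_val w ShiftL x y = push_bit y x mod 2 ^ w"
| "arith_val w ShiftR x y = drop_bit y x"

definition set_reg :: "nat \<Rightarrow> nat \<Rightarrow> config \<Rightarrow> config" where
  "set_reg r v s = s\<lparr>pc := Suc (pc s), regs := (regs s)(r := v)\<rparr>"

definition jump_if :: "bool \<Rightarrow> nat \<Rightarrow> config \<Rightarrow> config" where
  "jump_if b l s = s\<lparr>pc := (if b then l else Suc (pc s))\<rparr>"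

fun exec_instr :: "nat \<Rightarrow> instr \<Rightarrow> config \<Rightarrow> config" where
  "exec_instr w (Const r n) s = set_reg r (n mod 2 ^ w) s"
| "exec_instr w (Copy r q) s = set_reg r (regs s q) s"
| "exec_instr w (Arith f r p q) s = set_reg r (arith_val w f (regs s p) (regs s q)) s"
| "exec_instr w (Load r q) s = set_reg r (mem s (regs s q)) s"
| "exec_instr w (Store r q) s =
     s\<lparr>pc := Suc (pc s), mem := (mem s)(regs s r := regs s q)\<rparr>"
| "exec_instr w (Jump l) s = jump_if True l s"
| "exec_instr w (JumpEq r q l) s = jump_if (regs s r = regs s q) l s"
| "exec_instr w (JumpLess r q l) s = jump_if (regs s r < regs s q) l s"

text \<open>The machine halts by leaving the program; a halted configuration is left unchanged.\<close>

definition halted :: "instr list \<Rightarrow> config \<Rightarrow> bool" where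
  "halted P s \<longleftrightarrow> length P \<le> pc s"

definition step :: "nat \<Rightarrow> instr list \<Rightarrow> config \<Rightarrow> config" where
  "step w P s = (if halted P s then s else exec_instr w (P ! pc s) s)"

text \<open>The input occupies the memory cells from address 0 on; all other cells and all registers are
  initially 0. On halting, register 0 holds the address of the output and register 1 its length.\<close>

definition init_config :: "nat list \<Rightarrow> config" where
  "init_config xs =
     \<lparr>pc = 0, regs = (\<lambda>_. 0), mem = (\<lambda>n. if n < length xs then xs ! n else 0)\<rparr>"

definition result :: "config \<Rightarrow> nat list" where
  "result s = map (mem s) [regs s 0 ..< regs s 0 + regs s 1]"

definition computes_within :: "nat \<Rightarrow> instr list \<Rightarrow> nat list \<Rightarrow> nat list \<Rightarrow> real \<Rightarrow> bool" where
  "computes_within w P xs ys T \<longleftrightarrow>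
     (\<exists>t :: nat. real t \<le> T \<and> halted P ((step w P ^^ t) (init_config xs)) \<and>
                 result ((step w P ^^ t) (init_config xs)) = ys)"

text \<open>The word size is logarithmic in the input size. The size includes the dimensions, as indices
  have to fit into words; \<open>floorlog 2 n\<close> is the number of binary digits of \<open>n\<close>, and \<open>q\<close> is the
  constant of proportionality.\<close>

definition input_size :: "bool mat \<Rightarrow> bool mat \<Rightarrow> nat" where
  "input_size A B = dim_row A + dim_col A + dim_col B + length (encode_input A B)"

definition word_size :: "nat \<Rightarrow> bool mat \<Rightarrow> bool mat \<Rightarrow> nat" where
  "word_size q A B = q * floorlog 2 (input_size A B)"

text \<open>That an algorithm is combinatorial, i.e.\ does not use fast algebraic matrix multiplication as
  a subroutine, is an informal property. It is rendered by a restriction of the instruction set: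
  apart from copying, comparing, and indirect addressing, a combinatorial program may only add (as
  needed for counters and address arithmetic). The operations by which algebraic methods compute in
  a ring (subtraction, multiplication, modular reduction) and word-parallel operations are
  excluded.\<close>

definition combinatorial :: "instr list \<Rightarrow> bool" where
  "combinatorial P \<longleftrightarrow> (\<forall>f r p q. Arith f r p q \<in> set P \<longrightarrow> f = Add)"

end

theory Submission
  imports Defs
begin

text \<open>Let \<open>T\<close> be the number of triples \<open>(i, k, j)\<close> with \<open>A[i, k] = B[k, j] = 1\<close>. An entry of \<open>A\<close> lies
  in at most \<open>c\<close> triples, an entry of \<open>B\<close> in at most \<open>a\<close>, and an entry of \<open>C\<close> in at most \<open>b\<close>, so
  \<open>T \<le> (a + c) min(m\<^sub>A, m\<^sub>B)\<close> and \<open>T \<le> b m\<^sub>C\<close>, and \<open>T\<^sup>2 \<le> (ab + bc) min(m\<^sub>A, m\<^sub>B) m\<^sub>C\<close>. Hence it suffices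
  to enumerate all triples. The pairs \<open>(i, j)\<close> are first collected by column; traversing the columns in
  descending order and moving the pairs to stacks for the rows removes duplicates and leaves every row
  sorted, without a logarithmic factor. All this takes time \<open>O(m\<^sub>A + m\<^sub>B + a + c + T)\<close>. If \<open>A\<close> or \<open>B\<close> is
  zero, \<open>a + c\<close> need not be within the bound, so the program halts at once.\<close>

section \<open>Structured programs\<close>

datatype com =
    Block "instr list"
  | Seq com com (infixr ";;" 60)
  | IfNeq nat nat com
  | WhileNeq nat nat com

primrec csize :: "com \<Rightarrow> nat" where
  "csize (Block is) = length is"
| "csize (c1 ;; c2) = csize c1 + csize c2"
| "csize (IfNeq r q c) = Suc (csize c)"
| "csize (WhileNeq r q c) = csize c + 2"

text \<open>Jump targets are absolute, so the code of a command depends on the position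
  \<open>n\<close> at which it is placed.\<close>

primrec comp :: "nat \<Rightarrow> com \<Rightarrow> instr list" where
  "comp n (Block is) = is"
| "comp n (c1 ;; c2) = comp n c1 @ comp (n + csize c1) c2"
| "comp n (IfNeq r q c) = JumpEq r q (n + csize c + 1) # comp (n + 1) c"
| "comp n (WhileNeq r q c) = JumpEq r q (n + csize c + 2) # comp (n + 1) c @ [Jump n]"

lemma length_comp [simp]: "length (comp n c) = csize c"
  by (induction c arbitrary: n) auto

text \<open>A weakest precondition with a time bound: wherever the code of \<open>c\<close> is placed, it runs in at
  most \<open>T\<close> steps from its first position to just behind its last one.\<close>

definition tri ::
  "nat \<Rightarrow> com \<Rightarrow> (nat \<Rightarrow> nat) \<Rightarrow> (nat \<Rightarrow> nat) \<Rightarrow> nat \<Rightarrow> ((nat \<Rightarrow> nat) \<Rightarrow> (nat \<Rightarrow> nat) \<Rightarrow> bool) \<Rightarrow> bool"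
where
  "tri w c R m T Q \<longleftrightarrow> (\<forall>pre post. \<exists>t \<le> T. \<exists>R' m'.
     (step w (pre @ comp (length pre) c @ post) ^^ t) \<lparr>pc = length pre, regs = R, mem = m\<rparr>
       = \<lparr>pc = length pre + csize c, regs = R', mem = m'\<rparr> \<and> Q R' m')"

lemma tri_conseq:
  assumes "tri w c R m T Q" "T \<le> T'" "\<And>R m. Q R m \<Longrightarrow> Q' R m"
  shows "tri w c R m T' Q'"
  using assms unfolding tri_def by (meson order_trans)

text \<open>\<open>tri\<close> quantifies over all surroundings, so the code of \<open>c2\<close>
  can be counted as part of \<open>post\<close> while \<open>c1\<close> runs, and the code of
  \<open>c1\<close> as part of \<open>pre\<close> while \<open>c2\<close> runs.\<close>

lemma tri_seq:
  assumes 1: "tri w c1 R m T1 Q1" and 2: "\<And>R m. Q1 R m \<Longrightarrow> tri w c2 R m T2 Q"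
    and T: "T1 + T2 \<le> T"
  shows "tri w (c1 ;; c2) R m T Q"
  unfolding tri_def
proof (intro allI)
  fix pre post :: "instr list"
  let ?P = "pre @ comp (length pre) (c1 ;; c2) @ post"
  let ?q = "pre @ comp (length pre) c1"
  obtain t1 R1 m1 where t1: "t1 \<le> T1" "Q1 R1 m1"
    and s1: "(step w ?P ^^ t1) \<lparr>pc = length pre, regs = R, mem = m\<rparr>
       = \<lparr>pc = length pre + csize c1, regs = R1, mem = m1\<rparr>"
    using 1[unfolded tri_def, rule_format, of pre "comp (length pre + csize c1) c2 @ post"] by auto
  obtain t2 R2 m2 where t2: "t2 \<le> T2" "Q R2 m2"
    and s2: "(step w ?P ^^ t2) \<lparr>pc = length pre + csize c1, regs = R1, mem = m1\<rparr>
       = \<lparr>pc = length pre + csize c1 + csize c2, regs = R2, mem = m2\<rparr>"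
    using 2[OF t1(2), unfolded tri_def, rule_format, of ?q post] by auto
  have "(step w ?P ^^ (t2 + t1)) \<lparr>pc = length pre, regs = R, mem = m\<rparr>
       = \<lparr>pc = length pre + csize (c1 ;; c2), regs = R2, mem = m2\<rparr>"
    using s1 s2 by (simp add: funpow_add add.assoc)
  moreover have "t2 + t1 \<le> T" using t1 t2 T by simp
  ultimately show "\<exists>t\<le>T. \<exists>R' m'. (step w ?P ^^ t) \<lparr>pc = length pre, regs = R, mem = m\<rparr>
      = \<lparr>pc = length pre + csize (c1 ;; c2), regs = R', mem = m'\<rparr> \<and> Q R' m'"
    using t2(2) by blast
qed

lemma step_at:
  "pc s = length pre \<Longrightarrow> step w (pre @ i # post) s = exec_instr w i s"
  by (simp add: step_def halted_def nth_append)

lemma tri_if: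
  assumes 1: "R r \<noteq> R q \<Longrightarrow> tri w c R m T Q" and 2: "R r = R q \<Longrightarrow> Q R m" and T: "Suc T \<le> T'"
  shows "tri w (IfNeq r q c) R m T' Q"
  unfolding tri_def
proof (intro allI)
  fix pre post :: "instr list"
  let ?P = "pre @ comp (length pre) (IfNeq r q c) @ post"
  let ?j = "JumpEq r q (length pre + csize c + 1)"
  show "\<exists>t\<le>T'. \<exists>R' m'. (step w ?P ^^ t) \<lparr>pc = length pre, regs = R, mem = m\<rparr>
      = \<lparr>pc = length pre + csize (IfNeq r q c), regs = R', mem = m'\<rparr> \<and> Q R' m'"
  proof (cases "R r = R q")
    case True
    then have "(step w ?P ^^ 1) \<lparr>pc = length pre, regs = R, mem = m\<rparr>
      = \<lparr>pc = length pre + csize (IfNeq r q c), regs = R, mem = m\<rparr>"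
      by (simp add: step_at jump_if_def)
    moreover have "1 \<le> T'" using T by simp
    ultimately show ?thesis using 2[OF True] by blast
  next
    case False
    then have j: "step w ?P \<lparr>pc = length pre, regs = R, mem = m\<rparr>
      = \<lparr>pc = Suc (length pre), regs = R, mem = m\<rparr>"
      by (simp add: step_at jump_if_def)
    obtain t R' m' where t: "t \<le> T" "Q R' m'"
      and s: "(step w ?P ^^ t) \<lparr>pc = Suc (length pre), regs = R, mem = m\<rparr>
       = \<lparr>pc = Suc (length pre) + csize c, regs = R', mem = m'\<rparr>"
      using 1[OF False, unfolded tri_def, rule_format, of "pre @ [?j]" post] by auto
    have "(step w ?P ^^ Suc t) \<lparr>pc = length pre, regs = R, mem = m\<rparr>
      = \<lparr>pc = length pre + csize (IfNeq r q c), regs = R', mem = m'\<rparr>"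
      by (subst funpow_Suc_right) (simp only: o_apply j s, simp)
    moreover have "Suc t \<le> T'" using T t by simp
    ultimately show ?thesis using t(2) by blast
  qed
qed

text \<open>The two extra steps are the test at the head of the loop and the jump back to
  it.\<close>

lemma tri_while_unfold:
  assumes "R r \<noteq> R q" and body: "tri w c R m T1 Q1"
    and rest: "\<And>R m. Q1 R m \<Longrightarrow> tri w (WhileNeq r q c) R m T2 Q" and T: "T1 + 2 + T2 \<le> T"
  shows "tri w (WhileNeq r q c) R m T Q"
  unfolding tri_def
proof (intro allI)
  fix pre post :: "instr list"
  let ?P = "pre @ comp (length pre) (WhileNeq r q c) @ post"
  let ?j = "JumpEq r q (length pre + csize c + 2)"
  have j: "step w ?P \<lparr>pc = length pre, regs = R, mem = m\<rparr>
      = \<lparr>pc = Suc (length pre), regs = R, mem = m\<rparr>"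
    using assms(1) by (simp add: step_at jump_if_def)
  obtain t1 R1 m1 where t1: "t1 \<le> T1" "Q1 R1 m1"
    and s1: "(step w ?P ^^ t1) \<lparr>pc = Suc (length pre), regs = R, mem = m\<rparr>
       = \<lparr>pc = Suc (length pre) + csize c, regs = R1, mem = m1\<rparr>"
    using body[unfolded tri_def, rule_format, of "pre @ [?j]" "Jump (length pre) # post"] by auto
  have P: "?P = (pre @ ?j # comp (Suc (length pre)) c) @ Jump (length pre) # post" by simp
  have k: "step w ?P \<lparr>pc = Suc (length pre) + csize c, regs = R1, mem = m1\<rparr>
      = \<lparr>pc = length pre, regs = R1, mem = m1\<rparr>"
    unfolding P by (subst step_at) (simp_all add: jump_if_def)
  obtain t2 R2 m2 where t2: "t2 \<le> T2" "Q R2 m2"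
    and s2: "(step w ?P ^^ t2) \<lparr>pc = length pre, regs = R1, mem = m1\<rparr>
       = \<lparr>pc = length pre + csize (WhileNeq r q c), regs = R2, mem = m2\<rparr>"
    using rest[OF t1(2), unfolded tri_def, rule_format, of pre post] by auto
  have "(step w ?P ^^ (t2 + 1 + t1 + 1)) \<lparr>pc = length pre, regs = R, mem = m\<rparr>
      = \<lparr>pc = length pre + csize (WhileNeq r q c), regs = R2, mem = m2\<rparr>"
    unfolding funpow_add by (simp only: o_apply funpow_simps_right id_apply One_nat_def j s1 k s2)
  moreover have "t2 + 1 + t1 + 1 \<le> T" using T t1 t2 by simp
  ultimately show "\<exists>t\<le>T. \<exists>R' m'. (step w ?P ^^ t) \<lparr>pc = length pre, regs = R, mem = m\<rparr>
      = \<lparr>pc = length pre + csize (WhileNeq r q c), regs = R', mem = m'\<rparr> \<and> Q R' m'"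
    using t2(2) by blast
qed

lemma tri_while_exit:
  assumes "R r = R q" "Q R m" "1 \<le> T"
  shows "tri w (WhileNeq r q c) R m T Q"
  unfolding tri_def
proof (intro allI)
  fix pre post :: "instr list"
  let ?P = "pre @ comp (length pre) (WhileNeq r q c) @ post"
  have "(step w ?P ^^ 1) \<lparr>pc = length pre, regs = R, mem = m\<rparr>
      = \<lparr>pc = length pre + csize (WhileNeq r q c), regs = R, mem = m\<rparr>"
    using assms(1) by (simp add: step_at jump_if_def)
  then show "\<exists>t\<le>T. \<exists>R' m'. (step w ?P ^^ t) \<lparr>pc = length pre, regs = R, mem = m\<rparr>
      = \<lparr>pc = length pre + csize (WhileNeq r q c), regs = R', mem = m'\<rparr> \<and> Q R' m'"
    using assms(2,3) by blast
qed

text \<open>The invariant is indexed by the number of completed iterations, and their total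
  \<open>n\<close> is known beforehand, so termination needs no separate argument. The cost
  \<open>t k\<close> may vary with \<open>k\<close>; this lets an inner loop be charged its actual
  length and nested loops be bounded by a sum instead of a product.\<close>

lemma tri_while:
  assumes I0: "I 0 R m"
    and iter: "\<And>k R m. k < n \<Longrightarrow> I k R m \<Longrightarrow> R r \<noteq> R q \<and> tri w c R m (t k) (I (Suc k))"
    and exit: "\<And>R m. I n R m \<Longrightarrow> R r = R q \<and> Q R m"
    and T: "(\<Sum>k<n. t k + 2) + 1 \<le> T"
  shows "tri w (WhileNeq r q c) R m T Q"
proof -
  \<comment> \<open>Generalized to a loop entered after \<open>i\<close> iterations and proved by
    induction from \<open>n\<close> downwards.\<close>
  have "tri w (WhileNeq r q c) R m ((\<Sum>k\<in>{i..<n}. t k + 2) + 1) Q" if "i \<le> n" "I i R m" for i R m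
    using that
  proof (induction i arbitrary: R m rule: inc_induct)
    case base
    then show ?case using exit by (intro tri_while_exit) auto
  next
    case (step i)
    have "sum (\<lambda>k. t k + 2) {i..<n} = t i + 2 + (\<Sum>k\<in>{Suc i..<n}. t k + 2)"
      using step.hyps by (simp add: sum.atLeast_Suc_lessThan)
    moreover from iter[OF step.hyps(2) step.prems]
    have "R r \<noteq> R q" "tri w c R m (t i) (I (Suc i))" by auto
    ultimately show ?case
      by (intro tri_while_unfold[OF _ _ step.IH]) auto
  qed
  from this[of 0 R m] I0 show ?thesis
    using T by (simp add: atLeast0LessThan) (erule tri_conseq, simp_all)
qed

text \<open>Symbolic execution of jump-free code; the side conditions exclude overflow, so that \<open>Add\<close> is
  the addition of natural numbers.\<close>

fun blk :: "nat \<Rightarrow> instr list \<Rightarrow> (nat \<Rightarrow> nat) \<Rightarrow> (nat \<Rightarrow> nat) \<Rightarrow> ((nat \<Rightarrow> nat) \<Rightarrow> (nat \<Rightarrow> nat) \<Rightarrow> bool) \<Rightarrow> bool"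
where
  "blk w [] R m Q = Q R m"
| "blk w (Const r n # is) R m Q = (n < 2 ^ w \<and> blk w is (R(r := n)) m Q)"
| "blk w (Copy r q # is) R m Q = blk w is (R(r := R q)) m Q"
| "blk w (Arith Add r p q # is) R m Q = (R p + R q < 2 ^ w \<and> blk w is (R(r := R p + R q)) m Q)"
| "blk w (Load r q # is) R m Q = blk w is (R(r := m (R q))) m Q"
| "blk w (Store r q # is) R m Q = blk w is R (m(R r := R q)) Q"
| "blk w (_ # is) R m Q = False"

text \<open>Inductive step for straight-line code: the instruction just executed is moved to the end
  of the prefix.\<close>

lemma step_chain:
  assumes i: "exec_instr w i \<lparr>pc = length pre, regs = R, mem = m\<rparr> = \<lparr>pc = Suc (length pre), regs = R1, mem = m1\<rparr>"
    and rest: "\<exists>R' m'. (step w ((pre @ [i]) @ is @ post) ^^ length is) \<lparr>pc = length (pre @ [i]), regs = R1, mem = m1\<rparr>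
       = \<lparr>pc = length (pre @ [i]) + length is, regs = R', mem = m'\<rparr> \<and> Q R' m'"
  shows "\<exists>R' m'. (step w (pre @ (i # is) @ post) ^^ length (i # is)) \<lparr>pc = length pre, regs = R, mem = m\<rparr>
       = \<lparr>pc = length pre + length (i # is), regs = R', mem = m'\<rparr> \<and> Q R' m'"
proof -
  have "step w (pre @ (i # is) @ post) \<lparr>pc = length pre, regs = R, mem = m\<rparr>
      = \<lparr>pc = Suc (length pre), regs = R1, mem = m1\<rparr>"
    using i by (simp add: step_at)
  then show ?thesis
    using rest by (simp add: funpow_Suc_right del: funpow.simps(2))
qed

lemma tri_block:
  assumes "blk w is R m Q" "length is \<le> T"
  shows "tri w (Block is) R m T Q"
proof -
  have "\<exists>R' m'. (step w (pre @ is @ post) ^^ length is) \<lparr>pc = length pre, regs = R, mem = m\<rparr>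
       = \<lparr>pc = length pre + length is, regs = R', mem = m'\<rparr> \<and> Q R' m'" for pre post
    using assms(1)
  proof (induction w "is" R m Q arbitrary: pre rule: blk.induct)
    case (2 w r n "is" R m Q)
    show ?case
      by (rule step_chain[OF _ "2.IH"]) (use "2.prems" in \<open>simp_all add: set_reg_def fun_upd_def\<close>)
  next
    case (3 w r q "is" R m Q)
    show ?case
      by (rule step_chain[OF _ "3.IH"]) (use "3.prems" in \<open>simp_all add: set_reg_def fun_upd_def\<close>)
  next
    case (4 w r p q "is" R m Q)
    show ?case
      by (rule step_chain[OF _ "4.IH"]) (use "4.prems" in \<open>simp_all add: set_reg_def fun_upd_def\<close>)
  next
    case (5 w r q "is" R m Q)
    show ?case
      by (rule step_chain[OF _ "5.IH"]) (use "5.prems" in \<open>simp_all add: set_reg_def fun_upd_def\<close>)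
  next
    case (6 w r q "is" R m Q)
    show ?case
      by (rule step_chain[OF _ "6.IH"]) (use "6.prems" in \<open>simp_all add: set_reg_def fun_upd_def\<close>)
  qed auto
  then show ?thesis using assms(2) unfolding tri_def by auto
qed

lemma tri_blk_seq:
  assumes "blk w is R m (\<lambda>R m. tri w c R m T' Q)" "length is + T' \<le> T"
  shows "tri w (Block is ;; c) R m T Q"
  using assms tri_block[OF assms(1) order_refl] by (intro tri_seq) auto

section \<open>Linked stacks in memory\<close>

text \<open>A node at address \<open>p\<close> stores the address of the next node at \<open>p\<close> and its entry at \<open>p + 1\<close>;
  address 0 is the empty stack. All nodes lie between \<open>l\<close> and \<open>u\<close>.\<close>

primrec stack :: "(nat \<Rightarrow> nat) \<Rightarrow> nat \<Rightarrow> nat \<Rightarrow> nat \<Rightarrow> nat list \<Rightarrow> bool" where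
  "stack m l u p [] \<longleftrightarrow> p = 0"
| "stack m l u p (x # xs) \<longleftrightarrow>
     l \<le> p \<and> 0 < p \<and> Suc p < u \<and> m (Suc p) = x \<and> stack m l u (m p) xs"

lemma stack_cong:
  assumes "stack m l u p xs" "\<And>x. l \<le> x \<Longrightarrow> x < u \<Longrightarrow> m' x = m x" "u \<le> u'"
  shows "stack m' l u' p xs"
  using assms by (induction xs arbitrary: p) auto

definition stacks :: "(nat \<Rightarrow> nat) \<Rightarrow> nat \<Rightarrow> nat \<Rightarrow> nat \<Rightarrow> nat \<Rightarrow> (nat \<Rightarrow> nat list) \<Rightarrow> bool" where
  "stacks m l u base n F \<longleftrightarrow> (\<forall>h < n. stack m l u (m (base + h)) (F h))"

lemma stacks_cong:
  assumes "stacks m l u base n F" "\<And>x. l \<le> x \<Longrightarrow> x < u \<Longrightarrow> m' x = m x"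
    "\<And>h. h < n \<Longrightarrow> m' (base + h) = m (base + h)" "\<And>h. h < n \<Longrightarrow> F' h = F h" "u \<le> u'"
  shows "stacks m' l u' base n F'"
  using assms unfolding stacks_def by (metis stack_cong)

text \<open>The new node occupies the two cells at \<open>u\<close>, just above the region of the
  old nodes, so no old link is disturbed. The memory \<open>m'\<close> is described by its values
  instead of by updates; thus the rule also covers a node whose entry cell was filled before, as for
  the input entries of \<open>B\<close>.\<close>

lemma stacks_push:
  assumes s: "stacks m l u base n F" and h: "h < n" and l: "0 < l" "l \<le> u"
    and eq: "\<And>x. l \<le> x \<Longrightarrow> x < u \<Longrightarrow> m' x = m x"
    and node: "m' u = m (base + h)" "m' (Suc u) = v"
    and heads: "m' (base + h) = u" "\<And>h'. h' < n \<Longrightarrow> h' \<noteq> h \<Longrightarrow> m' (base + h') = m (base + h')"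
    and F': "\<And>h'. h' < n \<Longrightarrow> F' h' = (if h' = h then v # F h else F h')"
  shows "stacks m' l (Suc (Suc u)) base n F'"
  unfolding stacks_def
proof (intro allI impI)
  fix h' assume h': "h' < n"
  have *: "stack m' l (Suc (Suc u)) (m (base + h')) (F h')"
    by (rule stack_cong[of m l u]) (use s h' eq in \<open>auto simp: stacks_def\<close>)
  show "stack m' l (Suc (Suc u)) (m' (base + h')) (F' h')"
    using * F'[OF h'] heads node l h' by (cases "h' = h") auto
qed

text \<open>The list is reversed because the pair pushed last ends up on top of its stack.\<close>

definition bucket :: "(nat \<times> nat) list \<Rightarrow> nat \<Rightarrow> nat list" where
  "bucket ps h = map snd (filter (\<lambda>p. fst p = h) (rev ps))"

lemma bucket_Nil [simp]: "bucket [] h = []"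
  by (simp add: bucket_def)

lemma bucket_snoc: "bucket (ps @ [p]) h = (if fst p = h then snd p # bucket ps h else bucket ps h)"
  by (simp add: bucket_def)

lemma set_bucket: "set (bucket ps h) = {v. (h, v) \<in> set ps}"
  by (force simp: bucket_def)

lemma sum_length_bucket:
  assumes "\<And>h v. (h, v) \<in> set ps \<Longrightarrow> h < n"
  shows "(\<Sum>h<n. length (bucket ps h)) = length ps"
  using assms
proof (induction ps rule: rev_induct)
  case (snoc p ps)
  have IH: "(\<Sum>h<n. length (bucket ps h)) = length ps"
    by (rule snoc.IH) (use snoc.prems in auto)
  have "(\<Sum>h<n. length (bucket (ps @ [p]) h))
      = (\<Sum>h<n. length (bucket ps h) + (if h = fst p then 1 else 0))"
    by (intro sum.cong) (auto simp: bucket_snoc)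
  also have "\<dots> = length ps + 1"
    using snoc.prems[of "fst p" "snd p"] by (simp add: sum.distrib IH)
  finally show ?case by simp
qed simp

definition written :: "(nat \<Rightarrow> nat) \<Rightarrow> nat \<Rightarrow> (nat \<times> nat) list \<Rightarrow> bool" where
  "written m f ps \<longleftrightarrow> (\<forall>n < length ps. m (f + 2 * n) = fst (ps ! n) \<and> m (Suc (f + 2 * n)) = snd (ps ! n))"

lemma written_snoc:
  assumes "written m f ps" "g = f + 2 * length ps" "\<And>x. x < g \<Longrightarrow> m' x = m x" "m' g = i" "m' (Suc g) = j"
  shows "written m' f (ps @ [(i, j)])"
  using assms by (auto simp: written_def nth_append less_Suc_eq)

section \<open>The algorithm\<close>

text \<open>Registers: 2 and 3 hold the constants 0 and 1; 4, 5, 6 the dimensions \<open>a\<close>, \<open>b\<close>, \<open>c\<close>; 9 and 10 the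
  end of the entries of \<open>A\<close> and of \<open>B\<close>; from 10, 11, 12 on lie the stack heads for the rows of \<open>B\<close>, the
  columns of \<open>C\<close> and the rows of \<open>C\<close>; 13 is the next free address, and 14 the stack of all columns. The
  memory is initially 0, so the heads need no initialization.\<close>

text \<open>The cell of an entry of \<open>B\<close> that holds its row index is overwritten by a link, which turns the
  entry into a stack node.\<close>

definition link_rows :: com where
  "link_rows = Block [Copy 15 9] ;;
     WhileNeq 15 10 (Block
       [Load 16 15, Arith Add 17 10 16, Load 18 17, Store 15 18, Store 17 15,
        Arith Add 15 15 3, Arith Add 15 15 3])"

text \<open>An entry \<open>(i, k)\<close> of \<open>A\<close> leads to the stack of row
  \<open>k\<close> of \<open>B\<close>; each \<open>j\<close> found there causes a push of
  \<open>i\<close> on the stack of column \<open>j\<close>. This happens once per triple, so the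
  column stacks may contain repetitions.\<close>

definition multiply :: com where
  "multiply = Block [Copy 15 20] ;;
     WhileNeq 15 9
       (Block [Load 16 15, Arith Add 15 15 3, Load 17 15, Arith Add 15 15 3,
               Arith Add 17 10 17, Load 17 17] ;;
        WhileNeq 17 2 (Block
          [Arith Add 18 17 3, Load 18 18, Arith Add 18 11 18, Load 19 18,
           Store 13 19, Store 18 13, Arith Add 13 13 3, Store 13 16, Arith Add 13 13 3,
           Load 17 17]))"

text \<open>Counting down would call for subtraction. Pushing the columns in ascending order makes a
  later traversal of the stack run through them in descending order, with additions only.\<close>

definition stack_columns :: com where
  "stack_columns = Block [Copy 15 2] ;;
     WhileNeq 15 6 (Block
       [Store 13 14, Copy 14 13, Arith Add 13 13 3, Store 13 15, Arith Add 13 13 3,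
        Arith Add 15 15 3])"

text \<open>As the columns are traversed in descending order, \<open>j\<close> is already in the stack of row \<open>i\<close> iff it is
  on top. The top of an empty stack is read from cell 1, which therefore has to hold a value
  that is not a column; it is set to \<open>c\<close>.\<close>

definition transpose_product :: com where
  "transpose_product =
     WhileNeq 14 2
       (Block [Arith Add 15 14 3, Load 15 15, Arith Add 16 11 15, Load 17 16] ;;
        WhileNeq 17 2
          (Block [Arith Add 18 17 3, Load 18 18, Arith Add 18 12 18, Load 19 18,
                  Arith Add 20 19 3, Load 20 20] ;;
           IfNeq 20 15 (Block
             [Store 13 19, Store 18 13, Arith Add 13 13 3, Store 13 15, Arith Add 13 13 3]) ;;
           Block [Load 17 17]) ;;
        Block [Load 14 14])"

definition write_output :: com where
  "write_output = Block [Copy 0 13, Copy 15 2] ;;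
     WhileNeq 15 4
       (Block [Arith Add 16 12 15, Load 17 16] ;;
        WhileNeq 17 2 (Block
          [Store 13 15, Arith Add 13 13 3, Arith Add 18 17 3, Load 18 18, Store 13 18,
           Arith Add 13 13 3, Arith Add 1 1 3, Arith Add 1 1 3, Load 17 17]) ;;
        Block [Arith Add 15 15 3])"

section \<open>Memory layout and the lists that the phases of the algorithm produce\<close>

locale sparse_product =
  fixes a b c :: nat and As Bs :: "(nat \<times> nat) list" and B0 E HC HR H :: nat
  assumes As: "\<And>i k. (i, k) \<in> set As \<Longrightarrow> i < a \<and> k < b"
    and Bs: "\<And>k j. (k, j) \<in> set Bs \<Longrightarrow> k < b \<and> j < c"
    and B0: "B0 = 5 + 2 * length As" and E: "E = B0 + 2 * length Bs"
    and HC: "HC = E + b" and HR: "HR = HC + c" and H: "H = HR + a"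
begin

text \<open>The addresses delimit consecutive regions: five header cells, the entries of
  \<open>A\<close>, those of \<open>B\<close> from \<open>B0\<close>, the heads for the rows of
  \<open>B\<close> from \<open>E\<close>, for the columns of \<open>C\<close> from
  \<open>HC\<close>, for the rows of \<open>C\<close> from \<open>HR\<close>, and free memory from
  \<open>H\<close>.\<close>

lemma layout: "5 \<le> B0" "B0 \<le> E" "E \<le> HC" "HC \<le> HR" "HR \<le> H"
  using B0 E HC HR H by simp_all

lemma header_bounds: "h < b \<Longrightarrow> E + h < HC" "h < c \<Longrightarrow> HC + h < HR" "h < a \<Longrightarrow> HR + h < H"
  using HC HR H by simp_all

text \<open>The column comes first in these pairs, since \<open>bucket\<close> groups by the first
  component.\<close>

definition batch :: "nat \<times> nat \<Rightarrow> (nat \<times> nat) list" where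
  "batch e = map (\<lambda>j. (j, fst e)) (bucket Bs (snd e))"

definition prods :: "nat \<Rightarrow> (nat \<times> nat) list" where
  "prods n = concat (map batch (take n As))"

definition witnesses :: nat where
  "witnesses = length (prods (length As))"

definition column :: "nat \<Rightarrow> nat list" where
  "column = bucket (prods (length As))"

text \<open>Filtering an ascending list without repetitions fixes the order and multiplicity that
  the row stacks must have in the end.\<close>

definition row :: "nat \<Rightarrow> nat list" where
  "row i = filter (\<lambda>j. i \<in> set (column j)) [0..<c]"

definition outs :: "nat \<Rightarrow> (nat \<times> nat) list" where
  "outs n = concat (map (\<lambda>i. map (Pair i) (row i)) [0..<n])"

lemma prods_0 [simp]: "prods 0 = []"
  by (simp add: prods_def)

lemma prods_Suc: "n < length As \<Longrightarrow> prods (Suc n) = prods n @ batch (As ! n)"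
  by (simp add: prods_def take_Suc_conv_app_nth)

lemma outs_0 [simp]: "outs 0 = []"
  by (simp add: outs_def)

lemma outs_Suc: "outs (Suc n) = outs n @ map (Pair n) (row n)"
  by (simp add: outs_def)

lemma length_batch: "length (batch e) = length (bucket Bs (snd e))"
  by (simp add: batch_def)

lemma sum_length_batch: "n \<le> length As \<Longrightarrow> (\<Sum>k<n. length (batch (As ! k))) = length (prods n)"
  by (induction n) (auto simp: prods_Suc)

lemma length_prods_mono: "n \<le> n' \<Longrightarrow> length (prods n) \<le> length (prods n')"
proof (induction n' rule: dec_induct)
  case (step n')
  then show ?case by (cases "n' < length As") (auto simp: prods_Suc, simp add: prods_def)
qed simp

lemma length_outs_mono: "n \<le> n' \<Longrightarrow> length (outs n) \<le> length (outs n')"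
  by (induction n' rule: dec_induct) (auto simp: outs_Suc)

lemma prods_bounds:
  assumes "(j, i) \<in> set (prods n)"
  shows "j < c" "i < a"
  using assms As Bs by (auto simp: prods_def batch_def set_bucket dest!: in_set_takeD)

lemma column_bound: "i \<in> set (column j) \<Longrightarrow> i < a"
  by (auto simp: column_def set_bucket dest: prods_bounds)

lemma sum_length_column: "(\<Sum>j<c. length (column j)) = witnesses"
  unfolding column_def witnesses_def by (intro sum_length_bucket) (auto dest: prods_bounds)

end

text \<open>The left-hand side of \<open>big\<close> covers every address in use: two cells per
  column, two per triple for the column stacks, at most two per triple for the row stacks, and two
  per output entry.\<close>

locale sparse_product_machine = sparse_product +
  fixes w :: nat
  assumes big: "H + 2 * c + 4 * witnesses + 2 * length (outs a) + 2 < 2 ^ w"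
begin

text \<open>These registers stay constant through the first four phases. Register 1 is among them
  because it later counts the output words and has to start from 0.\<close>

definition fixed :: "(nat \<Rightarrow> nat) \<Rightarrow> bool" where
  "fixed R \<longleftrightarrow> R 1 = 0 \<and> R 2 = 0 \<and> R 3 = 1 \<and> R 4 = a \<and> R 6 = c \<and> R 9 = B0 \<and> R 10 = E \<and> R 11 = HC \<and> R 12 = HR"

lemma fixed_regs:
  assumes "fixed R"
  shows "R (Suc 0) = 0" "R 2 = 0" "R 3 = 1" "R 4 = a" "R 6 = c" "R 9 = B0" "R 10 = E"
    "R 11 = HC" "R 12 = HR"
  using assms by (simp_all add: fixed_def)

lemma fixed_upd [simp]: "r \<notin> {1, 2, 3, 4, 6, 9, 10, 11, 12} \<Longrightarrow> fixed (R(r := v)) = fixed R"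
  by (simp add: fixed_def)

section \<open>Loop invariants and costs of the five phases\<close>

lemma tri_link_rows:
  assumes R: "fixed R" "R 13 = H" "R 14 = 0" "R 20 = 5"
    and m: "\<And>n. n < length Bs \<Longrightarrow> m (B0 + 2 * n) = fst (Bs ! n) \<and> m (Suc (B0 + 2 * n)) = snd (Bs ! n)"
    and zero: "\<And>x. E \<le> x \<Longrightarrow> m x = 0"
  shows "tri w link_rows R m (9 * length Bs + 2) (\<lambda>R' m'. fixed R' \<and> R' 13 = H \<and> R' 14 = 0 \<and> R' 20 = 5 \<and>
      (\<forall>x<B0. m' x = m x) \<and> (\<forall>x\<ge>HC. m' x = 0) \<and> stacks m' B0 E E b (bucket Bs))"
proof -
  \<comment> \<open>The first \<open>k\<close> entries of \<open>B\<close> have become nodes, and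
    the later ones are still in their input form.\<close>
  define I where "I = (\<lambda>k R' m'. fixed R' \<and> R' 13 = H \<and> R' 14 = 0 \<and> R' 20 = 5 \<and> R' 15 = B0 + 2 * k \<and>
      (\<forall>x<B0. m' x = m x) \<and> (\<forall>x\<ge>HC. m' x = 0) \<and> (\<forall>x. B0 + 2 * k \<le> x \<and> x < E \<longrightarrow> m' x = m x) \<and>
      stacks m' B0 (B0 + 2 * k) E b (bucket (take k Bs)))"
  show ?thesis
    unfolding link_rows_def
  proof (rule tri_blk_seq, simp, rule tri_while[where n = "length Bs" and I = I and t = "\<lambda>_. 7"])
    show "I 0 (R(15 := R 9)) m"
      using R fixed_regs[OF R(1)] zero layout by (auto simp: I_def stacks_def)
  next
    fix k R m1
    assume k: "k < length Bs" and I: "I k R m1"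
    let ?h = "fst (Bs ! k)"
    have F: "fixed R" using I by (simp add: I_def)
    have h: "?h < b" using k Bs[of ?h "snd (Bs ! k)"] by simp
    have v: "m1 (B0 + 2 * k) = ?h" "m1 (Suc (B0 + 2 * k)) = snd (Bs ! k)"
      using I m[OF k] k E by (auto simp: I_def)
    have kE: "Suc (Suc (B0 + 2 * k)) \<le> E" using k E by simp
    have fits: "E + ?h < 2 ^ w" "Suc (Suc (B0 + 2 * k)) < 2 ^ w"
      using big h k HC HR H E by auto
    \<comment> \<open>The cell of the row index receives the old head; the next cell already holds
      the column, which is the entry of the node.\<close>
    let ?m = "m1(B0 + 2 * k := m1 (E + ?h), E + ?h := B0 + 2 * k)"
    have "stacks ?m B0 (Suc (Suc (B0 + 2 * k))) E b (bucket (take (Suc k) Bs))"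
    proof (rule stacks_push[where m = m1 and h = ?h and v = "snd (Bs ! k)" and F = "bucket (take k Bs)"])
      show "stacks m1 B0 (B0 + 2 * k) E b (bucket (take k Bs))" using I by (simp add: I_def)
    qed (use h v k kE layout in \<open>auto simp: take_Suc_conv_app_nth bucket_snoc\<close>)
    then have "I (Suc k) (R(16 := ?h, 17 := E + ?h, 18 := m1 (E + ?h), 15 := Suc (Suc (B0 + 2 * k)))) ?m"
      using I h kE header_bounds(1)[OF h] layout by (auto simp: I_def)
    then show "R 15 \<noteq> R 10 \<and> tri w (Block [Load 16 15, Arith Add 17 10 16, Load 18 17, Store 15 18,
        Store 17 15, Arith Add 15 15 3, Arith Add 15 15 3]) R m1 7 (I (Suc k))"
      by (intro conjI tri_block) (use I[unfolded I_def] fits v kE fixed_regs[OF F] in \<open>simp_all add: fun_upd_twist\<close>)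
  next
    fix R m1
    assume "I (length Bs) R m1"
    then show "R 15 = R 10 \<and> fixed R \<and> R 13 = H \<and> R 14 = 0 \<and> R 20 = 5 \<and>
      (\<forall>x<B0. m1 x = m x) \<and> (\<forall>x\<ge>HC. m1 x = 0) \<and> stacks m1 B0 E E b (bucket Bs)"
      using E fixed_regs[of R] by (simp add: I_def)
  qed auto
qed


lemma tri_multiply:
  assumes R: "fixed R" "R 13 = H" "R 14 = 0" "R 20 = 5"
    and m: "\<And>n. n < length As \<Longrightarrow> m (5 + 2 * n) = fst (As ! n) \<and> m (Suc (5 + 2 * n)) = snd (As ! n)"
    and zero: "\<And>x. HC \<le> x \<Longrightarrow> m x = 0"
    and rows: "stacks m B0 E E b (bucket Bs)"
  shows "tri w multiply R m (9 * length As + 12 * witnesses + 2) (\<lambda>R' m'. fixed R' \<and>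
      R' 13 = H + 2 * witnesses \<and> R' 14 = 0 \<and>
      (\<forall>x<HC. m' x = m x) \<and> (\<forall>i<a. m' (HR + i) = 0) \<and> stacks m' H (H + 2 * witnesses) HC c column)"
proof -
  \<comment> \<open>\<open>S ps\<close> describes the state after pushing \<open>ps\<close>;
    \<open>I\<close> and \<open>J\<close> instantiate it between two entries of \<open>A\<close> and
    within one. Everything below \<open>HC\<close> agrees with \<open>m\<close>, so the row stacks
    of \<open>B\<close> can be read off \<open>m\<close> throughout.\<close>
  define S where "S = (\<lambda>ps R' m'. fixed R' \<and> R' 13 = H + 2 * length ps \<and> R' 14 = 0 \<and>
      (\<forall>x<HC. m' x = m x) \<and> (\<forall>i<a. m' (HR + i) = 0) \<and> stacks m' H (H + 2 * length ps) HC c (bucket ps))"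
  define I where "I = (\<lambda>k R' m'. S (prods k) R' m' \<and> R' 15 = 5 + 2 * k)"
  define J where "J = (\<lambda>k l R' m'. S (prods k @ take l (batch (As ! k))) R' m' \<and>
      R' 15 = 5 + 2 * Suc k \<and> R' 16 = fst (As ! k) \<and>
      stack m B0 E (R' 17) (drop l (bucket Bs (snd (As ! k)))))"
  show ?thesis
    unfolding multiply_def
  \<comment> \<open>Per entry of \<open>A\<close>: six instructions and the last test of the inner
    loop, and for each node ten instructions with two jumps.\<close>
  proof (rule tri_blk_seq, simp, rule tri_while[where n = "length As" and I = I
        and t = "\<lambda>k. 7 + 12 * length (batch (As ! k))"])
    show "I 0 (R(15 := R 20)) m"
      using R fixed_regs[OF R(1)] zero layout by (auto simp: I_def S_def stacks_def)
  next
    fix k R m1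
    assume k: "k < length As" and I: "I k R m1"
    have F: "fixed R" using I by (simp add: I_def S_def)
    obtain i h where e: "As ! k = (i, h)" by fastforce
    have ih: "i < a" "h < b" using As[of i h] k e by (metis nth_mem)+
    have kB: "Suc (Suc (5 + 2 * k)) \<le> B0" using k B0 by simp
    have v: "m1 (5 + 2 * k) = i" "m1 (Suc (5 + 2 * k)) = h"
      using I m[OF k] kB layout e by (auto simp: I_def S_def)
    have p: "m1 (E + h) = m (E + h)"
      using I header_bounds(1)[OF ih(2)] by (auto simp: I_def S_def)
    have fits: "E + h < 2 ^ w" "Suc (Suc (5 + 2 * k)) < 2 ^ w"
      using big header_bounds(1)[OF ih(2)] kB layout by linarith+
    define n where "n = length (batch (As ! k))"
    have n: "n = length (bucket Bs h)" by (simp add: n_def length_batch e)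
    have ps: "length (prods k) + n \<le> witnesses"
      using length_prods_mono[of "Suc k" "length As"] k
      by (simp add: witnesses_def prods_Suc n_def)
    have "tri w (WhileNeq 17 2 (Block
          [Arith Add 18 17 3, Load 18 18, Arith Add 18 11 18, Load 19 18,
           Store 13 19, Store 18 13, Arith Add 13 13 3, Store 13 16, Arith Add 13 13 3,
           Load 17 17])) R' m1 (12 * n + 1) (I (Suc k))"
      if J0: "J k 0 R' m1" for R'
    proof (rule tri_while[where n = n and I = "J k" and t = "\<lambda>_. 10", OF J0])
      fix l R m1
      assume l: "l < n" and J: "J k l R m1"
      have F: "fixed R" using J by (simp add: J_def S_def)
      define j where "j = bucket Bs h ! l"
      have "j \<in> set (bucket Bs h)" using l n by (simp add: j_def)
      then have j: "j < c" using Bs by (auto simp: set_bucket)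
      have dr: "drop l (bucket Bs h) = j # drop (Suc l) (bucket Bs h)"
        using l n by (simp add: j_def Cons_nth_drop_Suc)
      define q where "q = R 17"
      have q: "B0 \<le> q" "Suc q < E" "m (Suc q) = j" "stack m B0 E (m q) (drop (Suc l) (bucket Bs h))"
        using J by (simp_all add: J_def e dr q_def)
      define qs where "qs = prods k @ take l (batch (As ! k))"
      define f where "f = H + 2 * length qs"
      have qs: "prods k @ take (Suc l) (batch (As ! k)) = qs @ [(j, i)]"
        using l n by (simp add: qs_def take_Suc_conv_app_nth n_def batch_def e j_def)
      have lqs: "length qs + 1 \<le> witnesses"
        using ps l by (simp add: qs_def n_def)
      have SR: "S qs R m1" "R 15 = 5 + 2 * Suc k" "R 16 = i" using J by (auto simp: J_def qs_def e)
      have hd: "HC + j < HR" using header_bounds(2)[OF j] .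
      have rows_below: "HR + i \<noteq> f \<and> HR + i \<noteq> Suc f \<and> HR + i \<noteq> HC + j" if "i < a" for i
        using header_bounds(3)[OF that] hd by (simp add: f_def)
      have fits: "HC + j < 2 ^ w" "Suc (Suc f) < 2 ^ w" "Suc q < 2 ^ w"
        using big hd layout lqs q by (simp_all add: f_def)
      have qf: "q \<noteq> f" "q \<noteq> Suc f" using q layout by (simp_all add: f_def)
      have val: "m1 (Suc q) = j" "m1 q = m q" using SR q layout by (auto simp: S_def)
      let ?m = "m1(f := m1 (HC + j), HC + j := f, Suc f := i)"
      have "stacks ?m H (Suc (Suc f)) HC c (bucket (qs @ [(j, i)]))"
      proof (rule stacks_push[where m = m1 and h = j and v = i and F = "bucket qs"])
        show "stacks m1 H f HC c (bucket qs)" using SR by (simp add: S_def f_def)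
      qed (use j hd layout header_bounds(2) in \<open>fastforce simp: f_def bucket_snoc\<close>)+
      then have "J k (Suc l) (R(18 := HC + j, 19 := m1 (HC + j), 13 := Suc (Suc f), 17 := m q)) ?m"
        using SR q val hd layout rows_below
        unfolding J_def qs S_def by (simp add: e f_def)
      then show "R 17 \<noteq> R 2 \<and> tri w (Block
          [Arith Add 18 17 3, Load 18 18, Arith Add 18 11 18, Load 19 18,
           Store 13 19, Store 18 13, Arith Add 13 13 3, Store 13 16, Arith Add 13 13 3,
           Load 17 17]) R m1 10 (J k (Suc l))"
        by (intro conjI tri_block)
          (use SR[unfolded S_def, folded f_def] fits val q qf hd layout fixed_regs[OF F] in \<open>simp_all add: q_def[symmetric] fun_upd_twist\<close>)
    next
      fix R m1
      assume "J k n R m1"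
      then show "R 17 = R 2 \<and> I (Suc k) R m1"
        using k n fixed_regs[of R] by (simp add: J_def I_def S_def prods_Suc n length_batch e)
    qed simp
    moreover have "J k 0 (R(16 := i, 15 := Suc (Suc (5 + 2 * k)), 17 := m (E + h))) m1"
      using I rows ih by (auto simp: J_def I_def S_def e stacks_def)
    ultimately show "R 15 \<noteq> R 9 \<and> tri w
       (Block [Load 16 15, Arith Add 15 15 3, Load 17 15, Arith Add 15 15 3,
               Arith Add 17 10 17, Load 17 17] ;;
        WhileNeq 17 2 (Block
          [Arith Add 18 17 3, Load 18 18, Arith Add 18 11 18, Load 19 18,
           Store 13 19, Store 18 13, Arith Add 13 13 3, Store 13 16, Arith Add 13 13 3,
           Load 17 17])) R m1 (7 + 12 * length (batch (As ! k))) (I (Suc k))"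
      by (intro conjI tri_blk_seq[where T' = "12 * n + 1"])
        (use I[unfolded I_def S_def] fits v kB p fixed_regs[OF F] in \<open>simp_all add: n_def fun_upd_twist\<close>)
  next
    fix R m1
    assume "I (length As) R m1"
    then show "R 15 = R 9 \<and> fixed R \<and> R 13 = H + 2 * witnesses \<and> R 14 = 0 \<and>
      (\<forall>x<HC. m1 x = m x) \<and> (\<forall>i<a. m1 (HR + i) = 0) \<and> stacks m1 H (H + 2 * witnesses) HC c column"
      using fixed_regs[of R] B0 by (simp add: I_def S_def witnesses_def column_def)
  next
    show "(\<Sum>k<length As. 7 + 12 * length (batch (As ! k)) + 2) + 1 \<le> 9 * length As + 12 * witnesses + 1"
      using sum_length_batch[of "length As"]
      by (simp add: sum.distrib sum_distrib_left[symmetric] witnesses_def)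
  qed simp
qed

lemma tri_stack_columns:
  assumes R: "fixed R" "R 13 = H + 2 * witnesses" "R 14 = 0"
  shows "tri w stack_columns R m (8 * c + 2) (\<lambda>R' m'. fixed R' \<and> R' 13 = H + 2 * witnesses + 2 * c \<and>
      (\<forall>x<H + 2 * witnesses. m' x = m x) \<and> stack m' H (H + 2 * witnesses + 2 * c) (R' 14) (rev [0..<c]))"
proof -
  define I where "I = (\<lambda>k R' m'. fixed R' \<and> R' 13 = H + 2 * witnesses + 2 * k \<and> R' 15 = k \<and>
      (\<forall>x<H + 2 * witnesses. m' x = m x) \<and> stack m' H (H + 2 * witnesses + 2 * k) (R' 14) (rev [0..<k]))"
  show ?thesis
    unfolding stack_columns_def
  proof (rule tri_blk_seq, simp, rule tri_while[where n = c and I = I and t = "\<lambda>_. 6"])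
    show "I 0 (R(15 := R 2)) m"
      using R fixed_regs[OF R(1)] by (auto simp: I_def)
  next
    fix k R m1
    assume k: "k < c" and I: "I k R m1"
    have F: "fixed R" using I by (simp add: I_def)
    define f where "f = R 13"
    have f: "f = H + 2 * witnesses + 2 * k" using I by (simp add: f_def I_def)
    have fits: "Suc (Suc f) < 2 ^ w" "Suc k < 2 ^ w"
      using big k layout HR by (simp_all add: f)
    let ?m = "m1(f := R 14, Suc f := k)"
    have "stack ?m H f (R 14) (rev [0..<k])"
      by (rule stack_cong[of m1 H f]) (use I in \<open>auto simp: I_def f_def\<close>)
    then have "stack ?m H (Suc (Suc f)) (R 14) (rev [0..<k])"
      by (rule stack_cong) auto
    then have "I (Suc k) (R(14 := f, 13 := Suc (Suc f), 15 := Suc k)) ?m"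
      using I f layout by (auto simp: I_def)
    then show "R 15 \<noteq> R 6 \<and> tri w (Block
       [Store 13 14, Copy 14 13, Arith Add 13 13 3, Store 13 15, Arith Add 13 13 3,
        Arith Add 15 15 3]) R m1 6 (I (Suc k))"
      by (intro conjI tri_block)
        (use I[unfolded I_def] fits k fixed_regs[OF F] in \<open>simp_all add: f_def[symmetric] fun_upd_twist\<close>)
  next
    fix R m1
    assume "I c R m1"
    then show "R 15 = R 6 \<and> fixed R \<and> R 13 = H + 2 * witnesses + 2 * c \<and>
      (\<forall>x<H + 2 * witnesses. m1 x = m x) \<and> stack m1 H (H + 2 * witnesses + 2 * c) (R 14) (rev [0..<c])"
      using fixed_regs[of R] by (simp add: I_def)
  qed auto
qed


lemma tri_transpose_product:
  assumes f3: "f3 = H + 2 * witnesses + 2 * c"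
    and R: "fixed R" "R 13 = f3" "stack m H f3 (R 14) (rev [0..<c])"
    and m1: "m (Suc 0) = c" and rows0: "\<And>i. i < a \<Longrightarrow> m (HR + i) = 0"
    and cols: "stacks m H f3 HC c column"
  shows "tri w transpose_product R m (8 * c + 15 * witnesses + 1) (\<lambda>R' m'. fixed R' \<and>
      R' 13 \<le> f3 + 2 * witnesses \<and> f3 \<le> R' 13 \<and> stacks m' H (R' 13) HR a row)"
proof -
  \<comment> \<open>\<open>D k i\<close> is the stack of row \<open>i\<close> after the
    \<open>k\<close> largest columns, and \<open>L k\<close> the number of entries in the stacks of
    these columns.\<close>
  define D where "D = (\<lambda>k i. filter (\<lambda>j. i \<in> set (column j)) [c - k..<c])"
  define L where "L = (\<lambda>k. \<Sum>k'<k. length (column (c - Suc k')))"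
  \<comment> \<open>The free address is only bounded from above, because repeated entries allocate
    no node. The cells from \<open>H\<close> to \<open>f3\<close> hold the stacks being traversed
    and stay unchanged.\<close>
  define S where "S = (\<lambda>F n R' m'. fixed R' \<and> f3 \<le> R' 13 \<and> R' 13 \<le> f3 + 2 * n \<and>
      (\<forall>x<HR. m' x = m x) \<and> (\<forall>x. H \<le> x \<and> x < f3 \<longrightarrow> m' x = m x) \<and> stacks m' H (R' 13) HR a F)"
  define I where "I = (\<lambda>k R' m'. S (D k) (L k) R' m' \<and> stack m H f3 (R' 14) (drop k (rev [0..<c])))"
  \<comment> \<open>The row stacks in the middle of column \<open>c - Suc k\<close>, after
    \<open>l\<close> of its entries.\<close>
  define G where "G = (\<lambda>k l i. if i \<in> set (take l (column (c - Suc k))) then (c - Suc k) # D k i else D k i)"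
  define J where "J = (\<lambda>k l R' m'. S (G k l) (L k + l) R' m' \<and> R' 15 = c - Suc k \<and>
      stack m H f3 (R' 17) (drop l (column (c - Suc k))) \<and> stack m H f3 (R' 14) (drop k (rev [0..<c])))"
  have Lc: "L c = witnesses"
    unfolding L_def using sum.nat_diff_reindex[of "\<lambda>j. length (column j)" c] sum_length_column by simp
  have Lmono: "L k \<le> witnesses" if "k \<le> c" for k
    unfolding Lc[symmetric] unfolding L_def by (rule sum_mono2) (use that in auto)
  have D_Suc: "D (Suc k) i = (if i \<in> set (column (c - Suc k)) then (c - Suc k) # D k i else D k i)"
    if "k < c" for k i
  proof -
    have "[c - Suc k..<c] = (c - Suc k) # [c - k..<c]"
      using that by (subst upt_conv_Cons) (simp_all add: Suc_diff_Suc)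
    then show ?thesis by (simp add: D_def)
  qed
  let ?inner = "Block [Arith Add 18 17 3, Load 18 18, Arith Add 18 12 18, Load 19 18,
                  Arith Add 20 19 3, Load 20 20] ;;
           IfNeq 20 15 (Block
             [Store 13 19, Store 18 13, Arith Add 13 13 3, Store 13 15, Arith Add 13 13 3]) ;;
           Block [Load 17 17]"
  show ?thesis
    unfolding transpose_product_def
  proof (rule tri_while[where n = c and I = I and t = "\<lambda>k. 6 + 15 * length (column (c - Suc k))"])
    show "I 0 R m"
      using R rows0 layout by (auto simp: I_def S_def stacks_def D_def L_def f3)
  next
    fix k R m1
    assume k: "k < c" and I: "I k R m1"
    have F: "fixed R" using I by (simp add: I_def S_def)
    define j where "j = c - Suc k"
    have j: "j < c" "j < c - k" using k by (simp_all add: j_def)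
    have dr: "drop k (rev [0..<c]) = j # drop (Suc k) (rev [0..<c])"
      using k by (subst Cons_nth_drop_Suc[symmetric]) (simp_all add: rev_nth j_def)
    define s where "s = R 14"
    have s: "H \<le> s" "0 < s" "Suc s < f3" "m (Suc s) = j" "stack m H f3 (m s) (drop (Suc k) (rev [0..<c]))"
      using I by (simp_all add: I_def dr s_def)
    have val: "m1 (Suc s) = j" using I s by (simp add: I_def S_def)
    have p: "m1 (HC + j) = m (HC + j)"
      using I header_bounds(2)[OF j(1)] by (simp add: I_def S_def)
    have fits: "Suc s < 2 ^ w" "HC + j < 2 ^ w"
      using big header_bounds(2)[OF j(1)] s layout by (simp_all add: f3)
    define n where "n = length (column j)"
    have n: "L k + n \<le> witnesses"
      using Lmono[of "Suc k"] k by (simp add: L_def n_def j_def)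
    have "tri w (WhileNeq 17 2 ?inner) R' m1 (15 * n + 1) (J k n)" if J0: "J k 0 R' m1" for R'
    proof (rule tri_while[where n = n and I = "J k" and t = "\<lambda>_. 13", OF J0])
      fix l R m1
      assume l: "l < n" and J: "J k l R m1"
      have F: "fixed R" using J by (simp add: J_def S_def)
      define i where "i = column j ! l"
      have "i \<in> set (column j)" using l by (simp add: n_def i_def)
      then have i: "i < a" by (rule column_bound)
      have dr: "drop l (column j) = i # drop (Suc l) (column j)"
        using l by (simp add: n_def i_def Cons_nth_drop_Suc)
      have tk: "take (Suc l) (column j) = take l (column j) @ [i]"
        using l by (simp add: n_def i_def take_Suc_conv_app_nth)
      define q where "q = R 17"
      have q: "H \<le> q" "0 < q" "Suc q < f3" "m (Suc q) = i" "stack m H f3 (m q) (drop (Suc l) (column j))"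
        using J by (simp_all add: J_def j_def[symmetric] dr q_def)
      define f where "f = R 13"
      have f: "f3 \<le> f" "f \<le> f3 + 2 * (L k + l)" using J by (simp_all add: J_def S_def f_def)
      have frame: "m1 x = m x" if "x < HR \<or> H \<le> x \<and> x < f3" for x
        using J that by (auto simp: J_def S_def)
      have st: "stacks m1 H f HR a (G k l)" using J by (simp add: J_def S_def f_def)
      have val: "m1 (Suc q) = i" "m1 q = m q" using frame q by simp_all
      have hd: "HR + i < H" by (rule header_bounds(3)[OF i])
      define p where "p = m1 (HR + i)"
      have stp: "stack m1 H f p (G k l i)" using st i by (simp add: stacks_def p_def)
      have "p = 0 \<or> Suc p < f" using stp by (cases "G k l i") auto
      then have fits: "Suc q < 2 ^ w" "HR + i < 2 ^ w" "Suc p < 2 ^ w" "Suc (Suc f) < 2 ^ w"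
        using q hd f big n l layout by (auto simp: f3)
      \<comment> \<open>If row \<open>i\<close> has received \<open>j\<close> already, then
        \<open>j\<close> is on top. Otherwise the top is a column of at least \<open>c - k\<close>,
        hence greater than \<open>j\<close>; for an empty stack \<open>p\<close> is 0 and the cell
        read is cell 1, which holds \<open>c\<close>.\<close>
      have head: "m1 (Suc p) = j \<longleftrightarrow> i \<in> set (take l (column j))"
      proof (cases "i \<in> set (take l (column j))")
        case True
        then show ?thesis using stp by (simp add: G_def j_def[symmetric])
      next
        case False
        then have st': "stack m1 H f p (D k i)" using stp by (simp add: G_def j_def[symmetric])
        have "m1 (Suc p) \<noteq> j"
        proof (cases "D k i")
          case Nil
          then show ?thesis using st' frame[of "Suc 0"] m1 layout j by simp
        next
          case (Cons y ys)
          then have "y \<in> set (D k i)" by simp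
          then have "c - k \<le> y" by (simp add: D_def)
          then show ?thesis using st' Cons j by simp
        qed
        then show ?thesis using False by simp
      qed
      define R2 where "R2 = R(18 := HR + i, 19 := p, 20 := m1 (Suc p))"
      \<comment> \<open>The invariant with the traversal pointer already advanced: both outcomes of
        the test establish it, and the final load turns it into \<open>J k (Suc l)\<close>.\<close>
      define J' where "J' = (\<lambda>R m'. J k (Suc l) (R(17 := m' (R 17))) m')"
      have R2: "R2 13 = f" "R2 3 = 1" "R2 15 = j" "R2 17 = q" "R2 18 = HR + i" "R2 19 = p" "R2 20 = m1 (Suc p)"
        using J fixed_regs[OF F] by (simp_all add: R2_def f_def q_def J_def j_def)
      have "tri w (IfNeq 20 15 (Block
             [Store 13 19, Store 18 13, Arith Add 13 13 3, Store 13 15, Arith Add 13 13 3])) R2 m1 6 J'"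
      proof (rule tri_if[where T = 5])
        assume "R2 20 = R2 15"
        then have "i \<in> set (take l (column j))" using head R2 by simp
        then have "set (take (Suc l) (column j)) = set (take l (column j))" using tk by auto
        then have "G k (Suc l) = G k l" by (simp add: G_def j_def)
        then show "J' R2 m1"
          using J q val by (simp add: J'_def J_def S_def R2_def q_def[symmetric] j_def)
      next
        assume "R2 20 \<noteq> R2 15"
        then have new: "i \<notin> set (take l (column j))" using head R2 by simp
        define M where "M = m1(f := p, HR + i := f, Suc f := j)"
        have frame': "M x = m x" if "x < HR \<or> H \<le> x \<and> x < f3" for x
          using frame[OF that] that f hd layout by (auto simp: M_def f3)
        have "stacks M H (Suc (Suc f)) HR a (G k (Suc l))"
        proof (rule stacks_push[where m = m1 and h = i and v = j and F = "G k l"])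
          show "stacks m1 H f HR a (G k l)" by (rule st)
          show "G k (Suc l) i' = (if i' = i then j # G k l i else G k l i')" for i'
            using new tk by (auto simp: G_def j_def[symmetric])
          show "M (HR + i') = m1 (HR + i')" if "i' < a" "i' \<noteq> i" for i'
            using header_bounds(3)[OF that(1)] that f by (simp add: M_def f3)
        qed (use i hd f layout in \<open>auto simp: M_def p_def f3\<close>)
        moreover have "M q = m q" by (rule frame') (use q in simp)
        ultimately have "J' (R2(13 := Suc (Suc f))) M"
          using J q f frame' by (auto simp: J'_def J_def S_def R2_def q_def[symmetric] j_def[symmetric])
        then show "tri w (Block [Store 13 19, Store 18 13, Arith Add 13 13 3, Store 13 15, Arith Add 13 13 3])
             R2 m1 5 J'"
          by (intro tri_block) (use R2 fits in \<open>simp_all add: M_def\<close>)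
      qed simp
      then have "tri w (IfNeq 20 15 (Block
             [Store 13 19, Store 18 13, Arith Add 13 13 3, Store 13 15, Arith Add 13 13 3]) ;;
           Block [Load 17 17]) R2 m1 7 (J k (Suc l))"
        by (rule tri_seq[where ?T2.0 = 1]) (auto simp: J'_def intro: tri_block)
      then show "R 17 \<noteq> R 2 \<and> tri w ?inner R m1 13 (J k (Suc l))"
        by (intro conjI tri_blk_seq[where T' = 7])
          (use fits val q fixed_regs[OF F] in \<open>simp_all add: q_def[symmetric] p_def[symmetric] R2_def fun_upd_twist\<close>)
    next
      fix R m1
      assume "J k n R m1"
      then show "R 17 = R 2 \<and> J k n R m1"
        using fixed_regs[of R] by (simp add: J_def S_def n_def j_def)
    qed simp
    moreover have "J k 0 (R(15 := j, 16 := HC + j, 17 := m (HC + j))) m1"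
      using I cols j by (simp add: J_def I_def S_def G_def j_def[symmetric] stacks_def)
    ultimately have loop: "tri w (WhileNeq 17 2 ?inner) (R(15 := j, 16 := HC + j, 17 := m (HC + j))) m1
        (15 * n + 1) (J k n)" by blast
    have close: "tri w (Block [Load 14 14]) R m1 1 (I (Suc k))" if J: "J k n R m1" for R m1
    proof (rule tri_block)
      have G: "G k n = D (Suc k)" using k by (auto simp: G_def D_Suc n_def j_def)
      have "stack m H f3 (R 14) (j # drop (Suc k) (rev [0..<c]))" using J by (simp add: J_def dr)
      then have s: "H \<le> R 14" "R 14 < f3" "stack m H f3 (m (R 14)) (drop (Suc k) (rev [0..<c]))" by simp_all
      have "m1 (R 14) = m (R 14)" using J s by (simp add: J_def S_def)
      moreover have "L (Suc k) = L k + n" by (simp add: L_def n_def j_def)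
      ultimately show "blk w [Load 14 14] R m1 (I (Suc k))"
        using J[unfolded J_def G] s by (simp add: I_def S_def)
    qed simp
    show "R 14 \<noteq> R 2 \<and> tri w
       (Block [Arith Add 15 14 3, Load 15 15, Arith Add 16 11 15, Load 17 16] ;;
        WhileNeq 17 2 ?inner ;; Block [Load 14 14]) R m1 (6 + 15 * length (column (c - Suc k))) (I (Suc k))"
      by (intro conjI tri_blk_seq[where T' = "15 * n + 2"])
        (use fits val p s tri_seq[OF loop close] fixed_regs[OF F] in
          \<open>simp_all add: s_def[symmetric] n_def j_def[symmetric] fun_upd_twist\<close>)
  next
    fix R m1
    assume "I c R m1"
    moreover have "D c = row" by (simp add: fun_eq_iff D_def row_def)
    ultimately show "R 14 = R 2 \<and> fixed R \<and> R 13 \<le> f3 + 2 * witnesses \<and> f3 \<le> R 13 \<and> stacks m1 H (R 13) HR a row"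
      using fixed_regs[of R] by (simp add: I_def S_def Lc)
  next
    show "(\<Sum>k<c. 6 + 15 * length (column (c - Suc k)) + 2) + 1 \<le> 8 * c + 15 * witnesses + 1"
      using Lc by (simp add: sum.distrib sum_distrib_left[symmetric] L_def)
  qed
qed

lemma tri_write_output:
  assumes R: "fixed R" "H \<le> R 13" "R 13 \<le> H + 4 * witnesses + 2 * c"
    and rows: "stacks m H (R 13) HR a row"
  shows "tri w write_output R m (6 * a + 11 * length (outs a) + 3) (\<lambda>R' m'.
      R' 1 = 2 * length (outs a) \<and> written m' (R' 0) (outs a))"
proof -
  define f where "f = R 13"
  \<comment> \<open>Register 1 now counts output words, so \<open>fixed\<close> fails; the constants
    still needed are listed one by one.\<close>
  define S where "S = (\<lambda>ps (R' :: nat \<Rightarrow> nat) m'. R' 0 = f \<and> R' 1 = 2 * length ps \<and> R' 2 = 0 \<and> R' 3 = 1 \<and> R' 4 = a \<and>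
      R' 12 = HR \<and> R' 13 = f + 2 * length ps \<and> (\<forall>x<f. m' x = m x) \<and> written m' f ps)"
  define I where "I = (\<lambda>k R' m'. S (outs k) R' m' \<and> R' 15 = k)"
  define J where "J = (\<lambda>k l R' m'. S (outs k @ take l (map (Pair k) (row k))) R' m' \<and> R' 15 = k \<and>
      stack m H f (R' 17) (drop l (row k)))"
  let ?inner = "Block [Store 13 15, Arith Add 13 13 3, Arith Add 18 17 3, Load 18 18, Store 13 18,
           Arith Add 13 13 3, Arith Add 1 1 3, Arith Add 1 1 3, Load 17 17]"
  have sum_row: "(\<Sum>k<n. length (row k)) = length (outs n)" for n
    by (induction n) (simp_all add: outs_Suc)
  show ?thesis
    unfolding write_output_def
  proof (rule tri_blk_seq, unfold blk.simps, rule tri_while[where n = a and I = I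
        and t = "\<lambda>k. 4 + 11 * length (row k)"])
    show "I 0 (R(0 := R 13, 15 := (R(0 := R 13)) 2)) m"
      using R fixed_regs[OF R(1)] by (simp add: I_def S_def written_def f_def)
  next
    fix k R m1
    assume k: "k < a" and I: "I k R m1"
    have hd: "HR + k < H" by (rule header_bounds(3)[OF k])
    have p: "m1 (HR + k) = m (HR + k)" using I hd R(2) by (simp add: I_def S_def f_def)
    have fits: "HR + k < 2 ^ w" "Suc k < 2 ^ w" using hd big by simp_all
    define n where "n = length (row k)"
    have n: "length (outs k) + n \<le> length (outs a)"
      using length_outs_mono[of "Suc k" a] k by (simp add: outs_Suc n_def)
    have "tri w (WhileNeq 17 2 ?inner) R' m1 (11 * n + 1) (J k n)" if J0: "J k 0 R' m1" for R'
    proof (rule tri_while[where n = n and I = "J k" and t = "\<lambda>_. 9", OF J0])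
      fix l R' m1
      assume l: "l < n" and J: "J k l R' m1"
      define j where "j = row k ! l"
      have dr: "drop l (row k) = j # drop (Suc l) (row k)"
        using l by (simp add: n_def j_def Cons_nth_drop_Suc)
      define q where "q = R' 17"
      have q: "H \<le> q" "0 < q" "Suc q < f" "m (Suc q) = j" "stack m H f (m q) (drop (Suc l) (row k))"
        using J by (simp_all add: J_def dr q_def)
      define ps where "ps = outs k @ take l (map (Pair k) (row k))"
      have ps: "outs k @ take (Suc l) (map (Pair k) (row k)) = ps @ [(k, j)]"
        using l by (simp add: ps_def take_Suc_conv_app_nth n_def j_def)
      have lps: "length ps + 1 \<le> length (outs a)" using n l by (simp add: ps_def n_def)
      define g where "g = f + 2 * length ps"
      have g: "f \<le> g" by (simp add: g_def)
      have SR: "S ps R' m1" "R' 15 = k" using J by (simp_all add: J_def ps_def)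
      have val: "m1 (Suc q) = j" "m1 q = m q" using SR q by (simp_all add: S_def)
      have fits: "Suc q < 2 ^ w" "Suc (Suc g) < 2 ^ w" "Suc (Suc (2 * length ps)) < 2 ^ w"
        using q big lps R(3) by (simp_all add: g_def f_def)
      let ?m = "m1(g := k, Suc g := j)"
      have "written ?m f (ps @ [(k, j)])"
        by (rule written_snoc[of m1 f ps g]) (use SR in \<open>auto simp: S_def g_def\<close>)
      then have "J k (Suc l) (R'(13 := Suc (Suc g), 18 := j, 1 := Suc (Suc (2 * length ps)), 17 := m q)) ?m"
        using SR q g unfolding J_def ps S_def by (simp add: g_def)
      then show "R' 17 \<noteq> R' 2 \<and> tri w ?inner R' m1 9 (J k (Suc l))"
        by (intro conjI tri_block)
          (use SR[unfolded S_def, folded g_def] fits val q g in \<open>simp_all add: q_def[symmetric] fun_upd_twist\<close>)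
    next
      fix R m1
      assume "J k n R m1"
      then show "R 17 = R 2 \<and> J k n R m1"
        by (simp add: J_def S_def n_def)
    qed simp
    moreover have "J k 0 (R(16 := HR + k, 17 := m (HR + k))) m1"
      using I rows k by (simp add: J_def I_def S_def stacks_def f_def)
    ultimately have loop: "tri w (WhileNeq 17 2 ?inner) (R(16 := HR + k, 17 := m (HR + k))) m1 (11 * n + 1) (J k n)"
      by blast
    have close: "tri w (Block [Arith Add 15 15 3]) R m1 1 (I (Suc k))" if J: "J k n R m1" for R m1
      by (rule tri_block) (use J fits in \<open>simp_all add: I_def J_def S_def outs_Suc n_def\<close>)
    show "R 15 \<noteq> R 4 \<and> tri w (Block [Arith Add 16 12 15, Load 17 16] ;;
        WhileNeq 17 2 ?inner ;; Block [Arith Add 15 15 3]) R m1 (4 + 11 * length (row k)) (I (Suc k))"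
      by (intro conjI tri_blk_seq[where T' = "11 * n + 2"])
        (use I[unfolded I_def S_def] fits p k tri_seq[OF loop close] in \<open>simp_all add: n_def fun_upd_twist\<close>)
  next
    fix R m1
    assume "I a R m1"
    then show "R 15 = R 4 \<and> R 1 = 2 * length (outs a) \<and> written m1 (R 0) (outs a)"
      by (simp add: I_def S_def)
  next
    show "(\<Sum>k<a. 4 + 11 * length (row k) + 2) + 1 \<le> 6 * a + 11 * length (outs a) + 1"
      using sum_row[of a] by (simp add: sum.distrib sum_distrib_left[symmetric])
  qed simp
qed

end

text \<open>After the header has been read, register 20 holds 5, the start of the entries of
  \<open>A\<close>. If either matrix is zero, the program ends with register 1 equal to 0, which is
  the empty output. \<open>Store 3 6\<close> uses the constant 1 as an address and writes
  \<open>c\<close> to cell 1, whose former content \<open>b\<close> is kept in register 5.\<close>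

definition sparse_mult :: com where
  "sparse_mult =
     Block [Const 3 1, Load 4 20, Arith Add 20 20 3, Load 5 20, Arith Add 20 20 3, Load 6 20,
            Arith Add 20 20 3, Load 7 20, Arith Add 20 20 3, Load 8 20, Arith Add 20 20 3] ;;
     IfNeq 7 2 (IfNeq 8 2
       (Block [Store 3 6, Arith Add 9 7 7, Arith Add 9 9 20, Arith Add 10 8 8, Arith Add 10 10 9,
               Arith Add 11 10 5, Arith Add 12 11 6, Arith Add 13 12 4] ;;
        link_rows ;; multiply ;; stack_columns ;; transpose_product ;; write_output))"

lemma combinatorial_sparse_mult: "combinatorial (comp 0 sparse_mult)"
  by (auto simp: combinatorial_def sparse_mult_def link_rows_def multiply_def stack_columns_def
      transpose_product_def write_output_def)

section \<open>Correctness and cost of the whole program\<close>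

context sparse_product_machine
begin

lemma tri_main:
  assumes R: "fixed R" "R 13 = H" "R 14 = 0" "R 20 = 5"
    and As_mem: "\<And>n. n < length As \<Longrightarrow> m (5 + 2 * n) = fst (As ! n) \<and> m (Suc (5 + 2 * n)) = snd (As ! n)"
    and Bs_mem: "\<And>n. n < length Bs \<Longrightarrow> m (B0 + 2 * n) = fst (Bs ! n) \<and> m (Suc (B0 + 2 * n)) = snd (Bs ! n)"
    and m1: "m (Suc 0) = c" and zero: "\<And>x. E \<le> x \<Longrightarrow> m x = 0"
    and T: "9 * length As + 9 * length Bs + 27 * witnesses + 16 * c + 6 * a + 11 * length (outs a) + 10 \<le> T"
  shows "tri w (link_rows ;; multiply ;; stack_columns ;; transpose_product ;; write_output) R m T
      (\<lambda>R' m'. R' 1 = 2 * length (outs a) \<and> written m' (R' 0) (outs a))"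
proof -
  define f3 where "f3 = H + 2 * witnesses + 2 * c"
  show ?thesis
  proof (rule tri_seq[OF tri_link_rows[OF R Bs_mem zero]])
    fix R1 n1
    assume 1: "fixed R1 \<and> R1 13 = H \<and> R1 14 = 0 \<and> R1 20 = 5 \<and>
      (\<forall>x<B0. n1 x = m x) \<and> (\<forall>x\<ge>HC. n1 x = 0) \<and> stacks n1 B0 E E b (bucket Bs)"
    have As1: "n1 (5 + 2 * n) = fst (As ! n) \<and> n1 (Suc (5 + 2 * n)) = snd (As ! n)" if "n < length As" for n
      using 1 As_mem[OF that] that B0 by simp
    have n1: "n1 (Suc 0) = c" using 1 m1 layout by simp
    show "tri w (multiply ;; stack_columns ;; transpose_product ;; write_output) R1 n1
        (9 * length As + 27 * witnesses + 16 * c + 6 * a + 11 * length (outs a) + 8)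
        (\<lambda>R' m'. R' 1 = 2 * length (outs a) \<and> written m' (R' 0) (outs a))"
    proof (rule tri_seq[OF tri_multiply[OF _ _ _ _ As1]])
      fix R2 n2
      assume 2: "fixed R2 \<and> R2 13 = H + 2 * witnesses \<and> R2 14 = 0 \<and>
        (\<forall>x<HC. n2 x = n1 x) \<and> (\<forall>i<a. n2 (HR + i) = 0) \<and> stacks n2 H (H + 2 * witnesses) HC c column"
      show "tri w (stack_columns ;; transpose_product ;; write_output) R2 n2
          (15 * witnesses + 16 * c + 6 * a + 11 * length (outs a) + 6)
          (\<lambda>R' m'. R' 1 = 2 * length (outs a) \<and> written m' (R' 0) (outs a))"
      proof (rule tri_seq[OF tri_stack_columns])
        fix R3 n3
        assume 3: "fixed R3 \<and> R3 13 = H + 2 * witnesses + 2 * c \<and>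
          (\<forall>x<H + 2 * witnesses. n3 x = n2 x) \<and> stack n3 H (H + 2 * witnesses + 2 * c) (R3 14) (rev [0..<c])"
        have n3: "n3 (Suc 0) = c" using 3 2 n1 layout by simp
        have rows3: "n3 (HR + i) = 0" if "i < a" for i
          using 3 2 that header_bounds(3)[OF that] by simp
        have hd: "HC + j < H + 2 * witnesses" if "j < c" for j
          using header_bounds(2)[OF that] layout by simp
        have cols3: "stacks n3 H f3 HC c column"
          by (rule stacks_cong[where m = n2 and u = "H + 2 * witnesses" and F = column])
            (use 3 2 hd in \<open>auto simp: f3_def\<close>)
        show "tri w (transpose_product ;; write_output) R3 n3
            (15 * witnesses + 8 * c + 6 * a + 11 * length (outs a) + 4)
            (\<lambda>R' m'. R' 1 = 2 * length (outs a) \<and> written m' (R' 0) (outs a))"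
        proof (rule tri_seq[OF tri_transpose_product[OF f3_def _ _ _ n3 rows3 cols3]])
          fix R4 n4
          assume "fixed R4 \<and> R4 13 \<le> f3 + 2 * witnesses \<and> f3 \<le> R4 13 \<and> stacks n4 H (R4 13) HR a row"
          then show "tri w write_output R4 n4 (6 * a + 11 * length (outs a) + 3)
              (\<lambda>R' m'. R' 1 = 2 * length (outs a) \<and> written m' (R' 0) (outs a))"
            by (intro tri_write_output) (auto simp: f3_def)
        qed (use 3 in \<open>auto simp: f3_def\<close>)
      qed (use 2 in auto)
    qed (use 1 in auto)
  qed (use T in auto)
qed

text \<open>The 13 steps are eleven instructions for the header and two tests. In the other case, 31
  adds eight instructions that compute the layout and the constant 10 from the phases.\<close>

definition running_time :: nat where
  "running_time = (if As = [] \<or> Bs = [] then 13 else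
     9 * (length As + length Bs) + 27 * witnesses + 16 * c + 6 * a + 11 * length (outs a) + 31)"

lemma tri_sparse_mult:
  assumes dims: "m 0 = a" "m 1 = b" "m 2 = c" "m 3 = length As" "m 4 = length Bs"
    and As_mem: "\<And>n. n < length As \<Longrightarrow> m (5 + 2 * n) = fst (As ! n) \<and> m (Suc (5 + 2 * n)) = snd (As ! n)"
    and Bs_mem: "\<And>n. n < length Bs \<Longrightarrow> m (B0 + 2 * n) = fst (Bs ! n) \<and> m (Suc (B0 + 2 * n)) = snd (Bs ! n)"
    and zero: "\<And>x. E \<le> x \<Longrightarrow> m x = 0"
  shows "tri w sparse_mult (\<lambda>_. 0) m running_time
      (\<lambda>R' m'. R' 1 = 2 * length (outs a) \<and> written m' (R' 0) (outs a))"
proof -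
  let ?Q = "\<lambda>R' m'. R' 1 = 2 * length (outs a) \<and> written m' (R' 0) (outs a)"
  define R :: "nat \<Rightarrow> nat" where "R = (\<lambda>_. 0)(3 := 1, 4 := a, 5 := b, 6 := c, 7 := length As, 8 := length Bs, 20 := Suc (Suc (Suc (Suc (Suc 0)))))"
  have Hw: "H < 2 ^ w" using big by simp
  have small: "Suc 0 < 2 ^ w" "Suc (Suc 0) < 2 ^ w" "Suc (Suc (Suc 0)) < 2 ^ w"
    "Suc (Suc (Suc (Suc 0))) < 2 ^ w" "Suc (Suc (Suc (Suc (Suc 0)))) < 2 ^ w"
    using Hw layout by simp_all
  have dims': "m (Suc 0) = b" "m (Suc (Suc 0)) = c" "m (Suc (Suc (Suc 0))) = length As"
    "m (Suc (Suc (Suc (Suc 0)))) = length Bs"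
    using dims by (simp_all add: numeral_eq_Suc)
  have R: "R 1 = 0" "R 2 = 0" "R 3 = 1" "R 4 = a" "R 5 = b" "R 6 = c" "R 7 = length As" "R 8 = length Bs"
    "R 14 = 0" "R 20 = 5"
    by (simp_all add: R_def)
  \<comment> \<open>For a zero matrix the guarded code is not entered, so its budget can be
    0.\<close>
  let ?T = "if As = [] \<or> Bs = [] then 0 else running_time - 13"
  have empty: "outs a = []" if "As = [] \<or> Bs = []"
  proof -
    have "prods n = []" for n using that by (auto simp: prods_def batch_def bucket_def)
    then show ?thesis by (simp add: outs_def row_def column_def bucket_def)
  qed
  have main: "tri w (Block [Store 3 6, Arith Add 9 7 7, Arith Add 9 9 20, Arith Add 10 8 8, Arith Add 10 10 9,
               Arith Add 11 10 5, Arith Add 12 11 6, Arith Add 13 12 4] ;;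
        link_rows ;; multiply ;; stack_columns ;; transpose_product ;; write_output) R m ?T ?Q"
    if ne: "As \<noteq> []" "Bs \<noteq> []"
  proof (rule tri_blk_seq)
    define R' where "R' = R(9 := B0, 10 := E, 11 := HC, 12 := HR, 13 := H)"
    have "tri w (link_rows ;; multiply ;; stack_columns ;; transpose_product ;; write_output) R' (m(Suc 0 := c))
        (?T - 8) ?Q"
      by (rule tri_main) (use ne As_mem Bs_mem zero layout in
          \<open>auto simp: R'_def R fixed_def R_def running_time_def\<close>)
    moreover have "length As + length As + 5 = B0" "length Bs + length Bs + B0 = E" "E + b = HC" "HC + c = HR" "HR + a = H"
      using B0 E HC HR H by simp_all
    moreover have "length As + length As < 2 ^ w" "length Bs + length Bs < 2 ^ w" "B0 < 2 ^ w" "E < 2 ^ w" "HC < 2 ^ w" "HR < 2 ^ w"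
      using Hw B0 E HC HR H by simp_all
    ultimately show "blk w [Store 3 6, Arith Add 9 7 7, Arith Add 9 9 20, Arith Add 10 8 8, Arith Add 10 10 9,
               Arith Add 11 10 5, Arith Add 12 11 6, Arith Add 13 12 4] R m
        (\<lambda>R m. tri w (link_rows ;; multiply ;; stack_columns ;; transpose_product ;; write_output) R m (?T - 8) ?Q)"
      using Hw by (simp add: R R'_def)
  qed (use ne in \<open>simp add: running_time_def\<close>)
  have branch: "tri w (IfNeq 7 2 (IfNeq 8 2
       (Block [Store 3 6, Arith Add 9 7 7, Arith Add 9 9 20, Arith Add 10 8 8, Arith Add 10 10 9,
               Arith Add 11 10 5, Arith Add 12 11 6, Arith Add 13 12 4] ;;
        link_rows ;; multiply ;; stack_columns ;; transpose_product ;; write_output))) R m (?T + 2) ?Q"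
    by (rule tri_if[where T = "?T + 1"], rule tri_if[where T = ?T])
      (use main empty in \<open>auto simp: R written_def simp del: One_nat_def\<close>)
  show ?thesis
    unfolding sparse_mult_def
    by (intro tri_blk_seq[where T' = "?T + 2"])
      (use branch dims dims' small in \<open>simp_all add: running_time_def R_def fun_upd_twist\<close>)
qed

end

section \<open>Encoding\<close>

definition flatten :: "(nat \<times> nat) list \<Rightarrow> nat list" where
  "flatten ps = concat (map (\<lambda>(i, j). [i, j]) ps)"

lemma length_flatten [simp]: "length (flatten ps) = 2 * length ps"
  by (induction ps) (auto simp: flatten_def)

lemma nth_flatten:
  "n < length ps \<Longrightarrow> flatten ps ! (2 * n) = fst (ps ! n) \<and> flatten ps ! Suc (2 * n) = snd (ps ! n)"
proof (induction ps arbitrary: n)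
  case (Cons p ps)
  then show ?case by (cases n; cases p) (auto simp: flatten_def)
qed simp

lemma encode_mat_flatten: "encode_mat M = flatten (coords M)"
  by (simp add: encode_mat_def flatten_def)

lemma distinct_coords: "distinct (coords M)"
  by (simp add: coords_def distinct_product)

lemma set_coords: "set (coords M) = {(i, j). i < dim_row M \<and> j < dim_col M \<and> M $$ (i, j)}"
  by (auto simp: coords_def)

lemma length_coords: "length (coords M) = num_ones M"
  using distinct_card[OF distinct_coords] by (simp add: num_ones_def set_coords)

lemma written_flatten:
  assumes "written m f ps"
  shows "map m [f..<f + 2 * length ps] = flatten ps"
proof (rule nth_equalityI)
  fix x assume "x < length (map m [f..<f + 2 * length ps])"
  then have x: "x < 2 * length ps" by simp
  obtain n where "x = 2 * n \<or> x = Suc (2 * n)" by (metis evenE oddE Suc_eq_plus1)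
  then show "map m [f..<f + 2 * length ps] ! x = flatten ps ! x"
    using assms x nth_flatten[of n ps] by (auto simp: written_def)
qed simp

section \<open>Counting witnesses\<close>

context sparse_product
begin

lemma set_column: "set (column j) = {i. \<exists>k. (i, k) \<in> set As \<and> (k, j) \<in> set Bs}"
  by (auto simp: column_def set_bucket prods_def batch_def) (metis fst_conv snd_conv image_eqI mem_Collect_eq)+

lemma set_outs: "set (outs a) = {(i, j). \<exists>k. (i, k) \<in> set As \<and> (k, j) \<in> set Bs}"
proof -
  have "(i, j) \<in> set (outs a) \<longleftrightarrow> i < a \<and> j < c \<and> i \<in> set (column j)" for i j
    by (auto simp: outs_def row_def)
  moreover have "i < a \<and> j < c" if "(i, k) \<in> set As" "(k, j) \<in> set Bs" for i j k
    using As[OF that(1)] Bs[OF that(2)] by simp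
  ultimately show ?thesis by (auto simp: set_column)
qed

text \<open>This brings \<open>outs a\<close> into the form of \<open>coords\<close>. Comparing the
  output with \<open>coords C\<close> then only takes an equality of sets, and distinctness follows
  as well.\<close>

lemma outs_filter: "outs a = filter (\<lambda>p. p \<in> set (outs a)) (List.product [0..<a] [0..<c])"
proof -
  define P where "P = (\<lambda>p. p \<in> set (outs a))"
  have "map (Pair i) (row i) = filter P (map (Pair i) [0..<c])" if "i < a" for i
  proof -
    have "P (i, j) \<longleftrightarrow> i \<in> set (column j)" if "j < c" for j
      using that \<open>i < a\<close> by (auto simp: P_def outs_def row_def)
    then show ?thesis
      unfolding filter_map o_def row_def by (intro arg_cong[where f = "map (Pair i)"] filter_cong) auto
  qed
  then have "outs a = concat (map (\<lambda>i. filter P (map (Pair i) [0..<c])) [0..<a])"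
    unfolding outs_def by (intro arg_cong[where f = concat] map_cong) auto
  also have "\<dots> = filter P (List.product [0..<a] [0..<c])"
    by (simp add: product_concat_map filter_concat o_def)
  finally show ?thesis by (simp only: P_def)
qed

lemma distinct_outs: "distinct (outs a)"
  by (subst outs_filter) (simp add: distinct_product)

context
  assumes distinct_As: "distinct As" and distinct_Bs: "distinct Bs"
begin

text \<open>Grouping by the entry of \<open>A\<close> makes the cardinality a sum over these
  entries, as in \<open>prods\<close>.\<close>

definition triples :: "((nat \<times> nat) \<times> nat) set" where
  "triples = (SIGMA e:set As. {j. (snd e, j) \<in> set Bs})"

lemma finite_triples: "finite triples"
  unfolding triples_def by (rule finite_subset[of _ "set As \<times> {..<c}"]) (auto dest: Bs)

lemma witnesses_eq_card: "witnesses = card triples"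
proof -
  have "length (bucket Bs k) = card {j. (k, j) \<in> set Bs}" for k
  proof -
    have "distinct (bucket Bs k)"
      using distinct_Bs by (auto simp: bucket_def distinct_map inj_on_def)
    then show ?thesis by (metis distinct_card set_bucket)
  qed
  moreover have "witnesses = (\<Sum>e\<in>set As. length (bucket Bs (snd e)))"
    using distinct_As
    by (simp add: witnesses_def prods_def length_concat o_def length_batch sum_list_distinct_conv_sum_set)
  moreover have "finite {j. (k, j) \<in> set Bs}" for k
    by (rule finite_subset[of _ "{..<c}"]) (auto dest: Bs)
  ultimately show ?thesis by (simp add: triples_def)
qed

lemma witnesses_le_As: "witnesses \<le> length As * c"
proof -
  have "card triples \<le> card (set As \<times> {..<c})"
    by (rule card_mono) (auto simp: triples_def dest: Bs)
  then show ?thesis using distinct_card[OF distinct_As] by (simp add: witnesses_eq_card card_cartesian_product)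
qed

text \<open>A triple is determined by its row and its entry of \<open>B\<close>.\<close>

lemma witnesses_le_Bs: "witnesses \<le> a * length Bs"
proof -
  have "card triples \<le> card ({..<a} \<times> set Bs)"
    by (rule card_inj_on_le[where f = "\<lambda>((i, k), j). (i, (k, j))"])
      (auto simp: triples_def inj_on_def dest: As)
  then show ?thesis using distinct_card[OF distinct_Bs] by (simp add: witnesses_eq_card card_cartesian_product)
qed

text \<open>A triple is determined by its middle index and the entry of \<open>C\<close> that it
  produces.\<close>

lemma witnesses_le_outs: "witnesses \<le> b * length (outs a)"
proof -
  have "card triples \<le> card ({..<b} \<times> set (outs a))"
  proof (rule card_inj_on_le)
    show "(\<lambda>((i, k), j). (k, (i, j))) ` triples \<subseteq> {..<b} \<times> set (outs a)"
      by (auto simp: triples_def set_outs dest: As)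
  qed (auto simp: inj_on_def)
  then show ?thesis using distinct_card[OF distinct_outs] by (simp add: witnesses_eq_card card_cartesian_product)
qed

text \<open>Each entry of \<open>C\<close> is the projection of some triple; hence writing the
  output costs no more than the order of the enumeration.\<close>

lemma outs_le_witnesses: "length (outs a) \<le> witnesses"
proof -
  have "set (outs a) = (\<lambda>((i, k), j). (i, j)) ` triples"
    by (force simp: triples_def set_outs image_iff)
  then have "card (set (outs a)) \<le> card triples"
    using card_image_le[OF finite_triples] by simp
  then show ?thesis using distinct_card[OF distinct_outs] by (simp add: witnesses_eq_card)
qed

end

end

section \<open>The running time\<close>

text \<open>Positive dimensions give \<open>a * b + b * c\<close> at least 2, so the logarithm is at
  least 1 and can be inserted as a factor. What remains is a comparison of squares of natural
  numbers.\<close>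

lemma sqrt_bound:
  fixes a b c n s z :: nat
  assumes n: "0 < n" and abc: "0 < a" "0 < b" "0 < c" and z: "z\<^sup>2 \<le> (a * b + b * c) * n * s"
  shows "real z \<le> sqrt (real (a * b + b * c) * real n * real s * log 2 (real (a * b + b * c)))"
proof (rule real_le_rsqrt)
  have "1 * 1 \<le> a * b" "1 * 1 \<le> b * c" using abc by (intro mult_le_mono; simp)+
  then have "2 \<le> a * b + b * c" by linarith
  then have "2 \<le> real (a * b + b * c)" by linarith
  then have l: "1 \<le> log 2 (real (a * b + b * c))" by simp
  have "real (z\<^sup>2) \<le> real ((a * b + b * c) * n * s)" using z by linarith
  then have "(real z)\<^sup>2 \<le> real (a * b + b * c) * real n * real s * 1" by simp
  also have "\<dots> \<le> real (a * b + b * c) * real n * real s * log 2 (real (a * b + b * c))"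
    using l by (intro mult_left_mono) auto
  finally show "(real z)\<^sup>2 \<le> real (a * b + b * c) * real n * real s * log 2 (real (a * b + b * c))" .
qed

lemma dims_bound:
  fixes a b c n s :: nat
  assumes "0 < n" "0 < b"
  shows "(a + c)\<^sup>2 \<le> (a * b + b * c) * n * (a + c + s)"
proof -
  have "(a + c)\<^sup>2 = ((a + c) * 1) * 1 * (a + c)" by (simp add: power2_eq_square)
  also have "\<dots> \<le> ((a + c) * b) * n * (a + c + s)" using assms by (intro mult_le_mono) auto
  finally show ?thesis by (simp add: algebra_simps)
qed

text \<open>One factor \<open>z\<close> is bounded through the entries of \<open>A\<close> and
  \<open>B\<close>, the other through the entries of \<open>C\<close>; the product of the bounds
  rearranges because \<open>(a + c) * b = a * b + b * c\<close>.\<close>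

lemma witnesses_bound:
  fixes a b c mA mB s z :: nat
  assumes "z \<le> mA * c" "z \<le> a * mB" "z \<le> b * s"
  shows "z\<^sup>2 \<le> (a * b + b * c) * min mA mB * (a + c + s)"
proof -
  have z: "z \<le> (a + c) * min mA mB"
    using assms(1,2) by (cases "mA \<le> mB") (auto simp: min_def algebra_simps intro: trans_le_add1 trans_le_add2)
  have "z\<^sup>2 \<le> ((a + c) * min mA mB) * (b * s)"
    unfolding power2_eq_square by (rule mult_le_mono[OF z assms(3)])
  also have "\<dots> = (a * b + b * c) * min mA mB * s" by (simp add: algebra_simps)
  also have "\<dots> \<le> (a * b + b * c) * min mA mB * (a + c + s)" by (intro mult_le_mono) auto
  finally show ?thesis .
qed

text \<open>The addresses are at most quadratic in the input size \<open>N\<close>, with a factor 2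
  that another \<open>N\<close> absorbs. So they stay below the cube of
  \<open>2 ^ floorlog 2 N\<close>, which is where the 3 comes from.\<close>

lemma word_bound:
  fixes N mA c z s q :: nat
  assumes N: "5 + 2 * mA + c \<le> N" and z: "z \<le> mA * c" "s \<le> z" and q: "3 \<le> q"
  shows "N + 2 * c + 4 * z + 2 * s + 2 < 2 ^ (q * floorlog 2 N)"
proof -
  \<comment> \<open>The difference of the two sides is the square of
    \<open>2 * mA - c\<close>.\<close>
  have "int (8 * (mA * c)) \<le> int ((2 * mA + c)\<^sup>2)"
    using zero_le_power2[of "2 * int mA - int c"] by (simp add: power2_eq_square algebra_simps)
  then have "8 * (mA * c) \<le> (2 * mA + c)\<^sup>2" by (simp only: of_nat_le_iff)
  also have "\<dots> \<le> N\<^sup>2" using N by (intro power_mono) auto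
  finally have "6 * z \<le> N\<^sup>2" using z(1) by linarith
  moreover have "5 * N \<le> N\<^sup>2" unfolding power2_eq_square using N by (intro mult_le_mono) auto
  ultimately have "N + 2 * c + 4 * z + 2 * s + 2 \<le> 2 * N\<^sup>2" using z N by linarith
  also have "\<dots> \<le> N * N\<^sup>2" using N by (intro mult_le_mono) auto
  also have "\<dots> = N ^ 3" by (simp add: power2_eq_square power3_eq_cube)
  also have "\<dots> < (2 ^ floorlog 2 N) ^ 3"
    using floorlog_bounds[of N 2] N by (intro power_strict_mono) auto
  also have "\<dots> \<le> 2 ^ (q * floorlog 2 N)"
    using q unfolding power_mult[symmetric] by (intro power_increasing) auto
  finally show ?thesis .
qed

lemma mult_log_ge:
  assumes "2 \<le> n"
  shows "real n \<le> real n * log 2 (real n)"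
proof -
  have "real n * 1 \<le> real n * log 2 (real n)" using assms by (intro mult_left_mono) auto
  then show ?thesis by simp
qed

text \<open>For a zero matrix the root vanishes, and the additive 1 in the bound pays for the
  constant number of steps.\<close>

lemma cost_zero:
  fixes s x :: real
  assumes "0 \<le> x" "s \<le> 13"
  shows "s \<le> 60 * (x + 0 + 1)"
  using assms by (simp add: algebra_simps)

text \<open>The root pays for triples and dimensions together, with coefficient 38 + 16 = 54. All
  coefficients and the constant are at most 60.\<close>

lemma cost_nonzero:
  fixes s x y z :: real and n d :: nat
  assumes "real n \<le> x" "real d \<le> y" "z \<le> y" "s \<le> 9 * real n + 38 * z + 16 * real d + 31"
  shows "s \<le> 60 * (x + y + 1)"
proof -
  have "0 \<le> x" "0 \<le> y" using assms(1,2) of_nat_0_le_iff order_trans by blast+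
  then have "s \<le> 9 * x + 54 * y + 31" using assms by linarith
  then show ?thesis using \<open>0 \<le> x\<close> \<open>0 \<le> y\<close> by (simp add: distrib_left)
qed

section \<open>The program on encoded matrices, and the final bound\<close>

lemma length_encode_input: "length (encode_input A B) = 5 + 2 * num_ones A + 2 * num_ones B"
  by (simp add: encode_input_def encode_mat_flatten length_coords)

lemma sparse_mult_correct:
  assumes A: "A \<in> carrier_mat a b" and B: "B \<in> carrier_mat b c" and C: "C = bool_mat_mult A B"
    and q: "3 \<le> q"
  shows "computes_within (word_size q A B) (comp 0 sparse_mult) (encode_input A B) (encode_mat C)
        (60 * (real (num_ones A + num_ones B) * log 2 (real (num_ones A + num_ones B))
              + sqrt (real (a * b + b * c) * real (min (num_ones A) (num_ones B)) * real (a + c + num_ones C)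
                      * log 2 (real (a * b + b * c)))
              + 1))"
    (is "computes_within ?w _ _ _ (60 * (?X + ?Y + 1))")
proof -
  define As where "As = coords A"
  define Bs where "Bs = coords B"
  define B0 where "B0 = 5 + 2 * length As"
  define E where "E = B0 + 2 * length Bs"
  define H where "H = E + b + c + a"
  have len: "length As = num_ones A" "length Bs = num_ones B"
    by (simp_all add: As_def Bs_def length_coords)
  have dist: "distinct As" "distinct Bs" by (simp_all add: As_def Bs_def distinct_coords)
  interpret sparse_product a b c As Bs B0 E "E + b" "E + b + c" H
    by unfold_locales (use A B in \<open>auto simp: As_def Bs_def set_coords B0_def E_def H_def\<close>)
  have outs: "outs a = coords C"
  proof -
    have "set (outs a) = set (coords C)"
      unfolding set_outs using A B by (auto simp: C As_def Bs_def set_coords bool_mat_mult_def)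
    then show ?thesis
      using A B by (subst outs_filter) (auto simp: coords_def C bool_mat_mult_def intro!: filter_cong)
  qed
  have lC: "length (outs a) = num_ones C" by (simp add: outs length_coords)
  note bounds = witnesses_le_As[OF dist] witnesses_le_Bs[OF dist] witnesses_le_outs[OF dist]
    outs_le_witnesses[OF dist]
  \<comment> \<open>The three head arrays take as many cells as the dimensions contribute to the
    input size, so free memory starts exactly at that size.\<close>
  have H_size: "H = input_size A B"
    using A B by (simp add: input_size_def length_encode_input H_def E_def B0_def len)
  interpret sparse_product_machine a b c As Bs B0 E "E + b" "E + b + c" H ?w
  proof
    have "5 + 2 * length As + c \<le> H" by (simp add: H_def E_def B0_def)
    from word_bound[OF this bounds(1,4) q]
    show "H + 2 * c + 4 * witnesses + 2 * length (outs a) + 2 < 2 ^ ?w"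
      by (simp add: word_size_def H_size)
  qed
  define m where "m = mem (init_config (encode_input A B))"
  have xs: "encode_input A B = [a, b, c, length As, length Bs] @ flatten As @ flatten Bs"
    using A B by (simp add: encode_input_def encode_mat_flatten len flip: As_def Bs_def)
  have "tri ?w sparse_mult (\<lambda>_. 0) m running_time
      (\<lambda>R' m'. R' 1 = 2 * length (outs a) \<and> written m' (R' 0) (outs a))"
  proof (rule tri_sparse_mult)
    fix n assume n: "n < length As"
    show "m (5 + 2 * n) = fst (As ! n) \<and> m (Suc (5 + 2 * n)) = snd (As ! n)"
      using n nth_flatten[OF n] by (simp add: m_def init_config_def xs nth_append)
  next
    fix n assume n: "n < length Bs"
    show "m (B0 + 2 * n) = fst (Bs ! n) \<and> m (Suc (B0 + 2 * n)) = snd (Bs ! n)"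
      using n nth_flatten[OF n] by (simp add: m_def init_config_def xs nth_append B0_def)
  qed (auto simp: m_def init_config_def xs E_def B0_def)
  \<comment> \<open>With empty surroundings the run starts at position 0 and ends just behind the
    program, which is a halted configuration.\<close>
  then obtain t R' m' where t: "t \<le> running_time"
    and run: "(step ?w (comp 0 sparse_mult) ^^ t) (init_config (encode_input A B))
       = \<lparr>pc = csize sparse_mult, regs = R', mem = m'\<rparr>"
    and R': "R' 1 = 2 * length (outs a)" "written m' (R' 0) (outs a)"
    unfolding tri_def by (drule_tac x = "[]" in spec, drule_tac x = "[]" in spec) (auto simp: m_def init_config_def)
  have "result \<lparr>pc = csize sparse_mult, regs = R', mem = m'\<rparr> = encode_mat C"
    using written_flatten[OF R'(2)] by (simp add: result_def R'(1)[simplified] outs encode_mat_flatten)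
  moreover have "real t \<le> 60 * (?X + ?Y + 1)"
  proof (cases "As = [] \<or> Bs = []")
    case True
    then have Y: "?Y = 0" using len by (auto simp: min_def)
    have "0 \<le> real n * log 2 (real n)" for n :: nat
      by (cases n) auto
    then have "0 \<le> ?X" .
    moreover have "real t \<le> 13" using t True by (simp add: running_time_def)
    ultimately show ?thesis unfolding Y by (rule cost_zero)
  next
    case False
    then have pos: "0 < num_ones A" "0 < num_ones B" by (simp_all flip: len)
    \<comment> \<open>A 1-entry in each matrix forces all three dimensions to be positive.\<close>
    obtain i k where "(i, k) \<in> set As" using False by (metis list.set_intros(1) neq_Nil_conv surj_pair)
    then have ab: "0 < a" "0 < b" using As by force+
    obtain k' j where "(k', j) \<in> set Bs" using False by (metis list.set_intros(1) neq_Nil_conv surj_pair)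
    then have c: "0 < c" using Bs by force
    have min: "0 < min (num_ones A) (num_ones B)" using pos by simp
    have "real (num_ones A + num_ones B) \<le> ?X" by (rule mult_log_ge) (use pos in simp)
    moreover have "real (a + c) \<le> ?Y"
      by (rule sqrt_bound[OF min ab c dims_bound[OF min ab(2)]])
    moreover have "real witnesses \<le> ?Y"
      by (rule sqrt_bound[OF min ab c witnesses_bound]) (use bounds in \<open>simp_all add: len lC\<close>)
    \<comment> \<open>The output has at most \<open>witnesses\<close> entries, so 27 + 11 = 38;
      \<open>16 * c + 6 * a\<close> is at most \<open>16 * (a + c)\<close>.\<close>
    moreover have "t \<le> 9 * (num_ones A + num_ones B) + 38 * witnesses + 16 * (a + c) + 31"
      using t False bounds(4) by (simp add: running_time_def len)
    then have "real t \<le> real (9 * (num_ones A + num_ones B) + 38 * witnesses + 16 * (a + c) + 31)"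
      by (simp only: of_nat_le_iff)
    then have "real t \<le> 9 * real (num_ones A + num_ones B) + 38 * real witnesses + 16 * real (a + c) + 31"
      by (simp only: of_nat_add of_nat_mult of_nat_numeral)
    ultimately show ?thesis by (rule cost_nonzero)
  qed
  ultimately show ?thesis
    unfolding computes_within_def by (intro exI[of _ t]) (simp add: run halted_def)
qed

theorem theorem9:
  shows "\<exists>(P :: instr list) (q\<^sub>0 :: nat) (K :: real). combinatorial P \<and>
    (\<forall>q \<ge> q\<^sub>0. \<forall>(a :: nat) (b :: nat) (c :: nat) (A :: bool mat) (B :: bool mat) (C :: bool mat)
        (m\<^sub>A :: nat) (m\<^sub>B :: nat) (m\<^sub>C :: nat).
      A \<in> carrier_mat a b \<longrightarrow> B \<in> carrier_mat b c \<longrightarrow> C = bool_mat_mult A B \<longrightarrow>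
      m\<^sub>A = num_ones A \<longrightarrow> m\<^sub>B = num_ones B \<longrightarrow> m\<^sub>C = num_ones C \<longrightarrow>
      computes_within (word_size q A B) P (encode_input A B) (encode_mat C)
        (K * (real (m\<^sub>A + m\<^sub>B) * log 2 (real (m\<^sub>A + m\<^sub>B))
              + sqrt (real (a * b + b * c) * real (min m\<^sub>A m\<^sub>B) * real (a + c + m\<^sub>C)
                      * log 2 (real (a * b + b * c)))
              + 1)))"
  \<comment> \<open>The witnesses are \<open>comp 0 sparse_mult\<close>, 3 for
    \<open>q\<^sub>0\<close> and 60 for \<open>K\<close>.\<close>
  using combinatorial_sparse_mult sparse_mult_correct by blast

end
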